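(* Let $\Omega\subset\mathbb R^d$ be a bounded Lipschitz domain, let $\beta>0$, let $g:[0,\infty)\to[0,\infty)$ be continuous and strictly increasing with $g(0)=0$, and let $P:\mathbb R\to[0,\infty)$ be continuous with $[t-1]^+\le P(t)\le [t]^+$ for all $t\in\mathbb R$ and $P(t)>0$ for all $t>0$. Let $\varrho,l,L>0$. Then there exist constants $r,R,a,A,\bar\varepsilon>0$ depending only on $d,\Omega,\varrho,l,L,P$ and $g$ such that for every $y\in C^0(\partial\Omega;\mathbb R^d)$ which is locally bi-Lipschitz in the sense that $$l|x_1-x_2|\le |y(x_1)-y(x_2)|\le L|x_1-x_2|\quad\text{for all } x_1,x_2\in\partial\Omega \text{ with } |x_1-x_2|<\varrho,$$ and for every $0<\varepsilon\le\bar\varepsilon$, $$a\,\mathcal H^{d-1}(P_y(r\varepsilon))\ \le\ \varepsilon^\beta E^{\partial\Omega}_\varepsilon(y)\ \le\ A\,\mathcal H^{d-1}(P_y(R\varepsilon)).$$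
   Context: $[a]^+:=\max\{0,a\}$, and $\mathcal H^{d-1}$ is the $(d-1)$-dimensional Hausdorff measure. For $\varepsilon>0$ the surface penalty functional is $$E^{\partial\Omega}_\varepsilon(y):=\frac1{\varepsilon^\beta}\int_{\partial\Omega}\int_{\partial\Omega}\frac1{\varepsilon^{d-1}}P\Big(g(|\tilde x-x|)-g\Big(\frac{|y(\tilde x)-y(x)|}{\varepsilon}\Big)\Big)\,d\mathcal H^{d-1}(\tilde x)\,d\mathcal H^{d-1}(x).$$ For $s\ge0$, $$P_y(s):=\{x\in\partial\Omega\mid \exists\,\tilde x\in\partial\Omega:\ |y(x)-y(\tilde x)|\le s\ \text{and}\ |x-\tilde x|>\tfrac{\varrho}{2}\}.$$ *)

theory Defs
  imports "HOL-Analysis.Analysis"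
begin

text \<open>
  The normalisation is the one for which the \<open>k\<close>-dimensional Hausdorff measure agrees with
  Lebesgue measure in \<open>k\<close>-dimensional Euclidean space.  The case distinction matters for
  \<open>k = 0\<close>: there \<open>(diameter U / 2) ^ 0 = 1\<close>, which is right for nonempty \<open>U\<close> only.
\<close>

definition hausdorff_weight :: "nat \<Rightarrow> 'a::metric_space set \<Rightarrow> ennreal" where
  "hausdorff_weight k U =
     (if U = {} then 0 else ennreal (unit_ball_vol (real k) * (diameter U / 2) ^ k))"

text \<open>
  Boundedness of the covering sets is required explicitly because \<open>diameter\<close> is real-valued and
  unspecified on unbounded sets.
\<close>

definition hausdorff_covers :: "real \<Rightarrow> 'a::metric_space set \<Rightarrow> (nat \<Rightarrow> 'a set) set" where
  "hausdorff_covers \<delta> A = {U. A \<subseteq> (\<Union>i. U i) \<and> (\<forall>i. bounded (U i) \<and> diameter (U i) \<le> \<delta>)}"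

definition hausdorff_premeasure :: "nat \<Rightarrow> real \<Rightarrow> 'a::metric_space set \<Rightarrow> ennreal" where
  "hausdorff_premeasure k \<delta> A = (INF U\<in>hausdorff_covers \<delta> A. \<Sum>i. hausdorff_weight k (U i))"

definition hausdorff_outer_measure :: "nat \<Rightarrow> 'a::metric_space set \<Rightarrow> ennreal" where
  "hausdorff_outer_measure k A = (SUP \<delta>\<in>{0<..}. hausdorff_premeasure k \<delta> A)"

text \<open>
  \<open>measure_of\<close> would yield the null measure if its third argument were not countably additive on
  the Borel sets; \<open>emeasure_hausdorff_measure\<close> below shows that it is.
\<close>

definition hausdorff_measure :: "nat \<Rightarrow> 'a::metric_space measure" where
  "hausdorff_measure k = measure_of UNIV (sets borel) (hausdorff_outer_measure k)"

lemma hausdorff_weight_empty [simp]: "hausdorff_weight k {} = 0"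
  by (simp add: hausdorff_weight_def)

lemma hausdorff_covers_mono:
  "A \<subseteq> B \<Longrightarrow> \<delta>' \<le> \<delta> \<Longrightarrow> hausdorff_covers \<delta>' B \<subseteq> hausdorff_covers \<delta> A"
  unfolding hausdorff_covers_def by (auto intro: order_trans)

lemma hausdorff_premeasure_mono:
  "A \<subseteq> B \<Longrightarrow> \<delta>' \<le> \<delta> \<Longrightarrow> hausdorff_premeasure k \<delta> A \<le> hausdorff_premeasure k \<delta>' B"
  unfolding hausdorff_premeasure_def by (intro INF_superset_mono hausdorff_covers_mono) auto

lemma hausdorff_outer_measure_mono:
  "A \<subseteq> B \<Longrightarrow> hausdorff_outer_measure k A \<le> hausdorff_outer_measure k B"
  unfolding hausdorff_outer_measure_def by (intro SUP_subset_mono hausdorff_premeasure_mono) auto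

lemma hausdorff_outer_measure_empty [simp]: "hausdorff_outer_measure k {} = 0"
proof -
  have "hausdorff_premeasure k \<delta> ({}::'a set) \<le> 0" if "\<delta> > 0" for \<delta>
    unfolding hausdorff_premeasure_def
    by (rule INF_lower2[of "\<lambda>_. {}"]) (use that in \<open>auto simp: hausdorff_covers_def\<close>)
  then have "hausdorff_outer_measure k ({}::'a set) \<le> 0"
    unfolding hausdorff_outer_measure_def by (intro SUP_least) auto
  then show ?thesis by simp
qed

lemma hausdorff_premeasure_countably_subadditive:
  "hausdorff_premeasure k \<delta> (\<Union>i. A i) \<le> (\<Sum>i. hausdorff_premeasure k \<delta> (A i))"
proof (rule ennreal_le_epsilon)
  fix e :: real
  assume e: "0 < e" and fin: "(\<Sum>i. hausdorff_premeasure k \<delta> (A i)) < top"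
  have lt: "hausdorff_premeasure k \<delta> (A n) < hausdorff_premeasure k \<delta> (A n) + e * (1/2)^Suc n" for n
    using e fin by (auto simp add: less_top dest!: ennreal_suminf_lessD)
  have "\<exists>U\<in>hausdorff_covers \<delta> (A n). (\<Sum>i. hausdorff_weight k (U i))
          < hausdorff_premeasure k \<delta> (A n) + e * (1/2)^Suc n" for n
    using lt[of n] unfolding hausdorff_premeasure_def INF_less_iff by simp
  then obtain B where B: "\<And>n. B n \<in> hausdorff_covers \<delta> (A n)"
    and Ble: "\<And>n. (\<Sum>i. hausdorff_weight k (B n i))
                \<le> hausdorff_premeasure k \<delta> (A n) + e * (1/2)^Suc n"
    by (metis less_imp_le)
  define C where "C = case_prod B o prod_decode"
  have "C \<in> hausdorff_covers \<delta> (\<Union>i. A i)"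
  proof -
    have "x \<in> (\<Union>i. C i)" if "x \<in> A n" for x n
    proof -
      have "A n \<subseteq> (\<Union>i. B n i)"
        using B[of n] by (simp add: hausdorff_covers_def)
      with that obtain j where "x \<in> B n j" by blast
      then have "x \<in> C (prod_encode (n, j))" by (simp add: C_def)
      then show ?thesis by blast
    qed
    then show ?thesis
      using B by (auto simp: hausdorff_covers_def C_def split_def)
  qed
  then have "hausdorff_premeasure k \<delta> (\<Union>i. A i) \<le> (\<Sum>i. hausdorff_weight k (C i))"
    unfolding hausdorff_premeasure_def by (rule INF_lower)
  also have "\<dots> = (\<Sum>i. (\<lambda>p. hausdorff_weight k (B (fst p) (snd p))) (prod_decode i))"
    by (simp add: C_def split_def)
  also have "\<dots> = (\<Sum>n. \<Sum>i. hausdorff_weight k (B n i))"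
    by (intro suminf_ennreal_2dimen) auto
  also have "\<dots> \<le> (\<Sum>n. hausdorff_premeasure k \<delta> (A n) + e * (1/2) ^ Suc n)"
    by (intro suminf_le Ble) auto
  also have "\<dots> = (\<Sum>n. hausdorff_premeasure k \<delta> (A n)) + (\<Sum>n. ennreal e * ennreal ((1/2) ^ Suc n))"
    using e by (subst suminf_add[symmetric])
               (auto simp del: ennreal_suminf_cmult simp add: ennreal_mult[symmetric])
  also have "\<dots> = (\<Sum>n. hausdorff_premeasure k \<delta> (A n)) + e"
    unfolding ennreal_suminf_cmult
    by (subst suminf_ennreal_eq[OF zero_le_power power_half_series]) auto
  finally show "hausdorff_premeasure k \<delta> (\<Union>i. A i) \<le> (\<Sum>n. hausdorff_premeasure k \<delta> (A n)) + e" .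
qed

lemma hausdorff_outer_measure_countably_subadditive:
  "hausdorff_outer_measure k (\<Union>i. A i) \<le> (\<Sum>i. hausdorff_outer_measure k (A i))"
  unfolding hausdorff_outer_measure_def[of k "\<Union>i. A i"]
proof (rule SUP_least)
  fix \<delta> :: real
  assume \<delta>: "\<delta> \<in> {0<..}"
  have "(\<Sum>i. hausdorff_premeasure k \<delta> (A i)) \<le> (\<Sum>i. hausdorff_outer_measure k (A i))"
    unfolding hausdorff_outer_measure_def using \<delta> by (intro suminf_le SUP_upper) auto
  then show "hausdorff_premeasure k \<delta> (\<Union>i. A i) \<le> (\<Sum>i. hausdorff_outer_measure k (A i))"
    using hausdorff_premeasure_countably_subadditive order_trans by blast
qed

lemma outer_measure_space_hausdorff:
  "outer_measure_space (Pow UNIV) (hausdorff_outer_measure k)"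
  by (auto simp: outer_measure_space_def positive_def increasing_def countably_subadditive_def
      intro: hausdorff_outer_measure_mono hausdorff_outer_measure_countably_subadditive)

lemma hausdorff_outer_measure_Un_le:
  "hausdorff_outer_measure k (A \<union> B) \<le> hausdorff_outer_measure k A + hausdorff_outer_measure k B"
proof -
  interpret sigma_algebra UNIV "Pow UNIV :: 'a set set"
    by (rule sigma_algebra_Pow)
  have "subadditive (Pow (UNIV :: 'a set)) (hausdorff_outer_measure k)"
    using outer_measure_space_hausdorff
    by (intro countably_subadditive_subadditive) (auto simp: outer_measure_space_def)
  then have "hausdorff_outer_measure k (A \<union> (B - A)) \<le> hausdorff_outer_measure k A + hausdorff_outer_measure k (B - A)"
    by (intro subadditiveD) auto
  also have "\<dots> \<le> hausdorff_outer_measure k A + hausdorff_outer_measure k B"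
    by (intro add_left_mono hausdorff_outer_measure_mono) auto
  finally show ?thesis by simp
qed

lemma hausdorff_outer_measure_separated:
  assumes e: "e > 0" and sep: "\<And>x y. x \<in> A \<Longrightarrow> y \<in> B \<Longrightarrow> e \<le> dist x y"
  shows "hausdorff_outer_measure k A + hausdorff_outer_measure k B \<le> hausdorff_outer_measure k (A \<union> B)"
proof -
  have pre: "hausdorff_premeasure k \<delta> A + hausdorff_premeasure k \<delta> B \<le> hausdorff_premeasure k \<delta> (A \<union> B)"
    if \<delta>: "0 < \<delta>" "\<delta> < e" for \<delta>
    unfolding hausdorff_premeasure_def[of k \<delta> "A \<union> B"]
  proof (rule INF_greatest)
    fix U assume U: "U \<in> hausdorff_covers \<delta> (A \<union> B)"
    define UA where "UA i = (if U i \<inter> A = {} then {} else U i)" for i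
    define UB where "UB i = (if U i \<inter> B = {} then {} else U i)" for i
    have "UA \<in> hausdorff_covers \<delta> A" "UB \<in> hausdorff_covers \<delta> B"
      using U \<delta> unfolding hausdorff_covers_def UA_def UB_def by (fastforce split: if_splits)+
    then have "hausdorff_premeasure k \<delta> A + hausdorff_premeasure k \<delta> B
        \<le> (\<Sum>i. hausdorff_weight k (UA i)) + (\<Sum>i. hausdorff_weight k (UB i))"
      unfolding hausdorff_premeasure_def by (intro add_mono INF_lower)
    also have "\<dots> = (\<Sum>i. hausdorff_weight k (UA i) + hausdorff_weight k (UB i))"
      by (intro suminf_add) auto
    also have "\<dots> \<le> (\<Sum>i. hausdorff_weight k (U i))"
    proof (intro suminf_le)
      fix i
      have "U i \<inter> A = {} \<or> U i \<inter> B = {}"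
      proof (rule ccontr)
        assume "\<not> ?thesis"
        then obtain x y where xy: "x \<in> U i" "x \<in> A" "y \<in> U i" "y \<in> B" by auto
        have "e \<le> dist x y" using xy sep by auto
        also have "\<dots> \<le> diameter (U i)"
          using U xy by (intro diameter_bounded_bound) (auto simp: hausdorff_covers_def)
        also have "\<dots> \<le> \<delta>" using U by (auto simp: hausdorff_covers_def)
        finally show False using \<delta> by simp
      qed
      then show "hausdorff_weight k (UA i) + hausdorff_weight k (UB i) \<le> hausdorff_weight k (U i)"
        by (auto simp: UA_def UB_def)
    qed auto
    finally show "hausdorff_premeasure k \<delta> A + hausdorff_premeasure k \<delta> B \<le> (\<Sum>i. hausdorff_weight k (U i))" .
  qed
  have "hausdorff_outer_measure k A + hausdorff_outer_measure k B
      = (SUP \<delta>\<in>{0<..}. hausdorff_premeasure k \<delta> A + hausdorff_premeasure k \<delta> B)"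
    unfolding hausdorff_outer_measure_def
  proof (rule SUP_add_directed_ennreal[symmetric])
    fix i j :: real
    assume "i \<in> {0<..}" "j \<in> {0<..}"
    then show "\<exists>m\<in>{0<..}. hausdorff_premeasure k i A + hausdorff_premeasure k j B
        \<le> hausdorff_premeasure k m A + hausdorff_premeasure k m B"
      by (intro bexI[of _ "min i j"] add_mono hausdorff_premeasure_mono) auto
  qed
  also have "\<dots> \<le> hausdorff_outer_measure k (A \<union> B)"
  proof (rule SUP_least)
    fix \<delta> :: real
    assume \<delta>: "\<delta> \<in> {0<..}"
    define m where "m = min \<delta> (e / 2)"
    have m: "0 < m" "m < e" "m \<le> \<delta>" using \<delta> e by (auto simp: m_def)
    have "hausdorff_premeasure k \<delta> A + hausdorff_premeasure k \<delta> B
        \<le> hausdorff_premeasure k m A + hausdorff_premeasure k m B"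
      using m by (intro add_mono hausdorff_premeasure_mono) auto
    also have "\<dots> \<le> hausdorff_premeasure k m (A \<union> B)" using m by (intro pre)
    also have "\<dots> \<le> hausdorff_outer_measure k (A \<union> B)"
      unfolding hausdorff_outer_measure_def using m by (intro SUP_upper) auto
    finally show "hausdorff_premeasure k \<delta> A + hausdorff_premeasure k \<delta> B \<le> hausdorff_outer_measure k (A \<union> B)" .
  qed
  finally show ?thesis .
qed

lemma hausdorff_outer_measure_infdist:
  assumes "t < s" "A \<subseteq> {x. s \<le> infdist x C}" "B \<subseteq> {x. infdist x C \<le> t}"
  shows "hausdorff_outer_measure k A + hausdorff_outer_measure k B \<le> hausdorff_outer_measure k (A \<union> B)"
proof (rule hausdorff_outer_measure_separated[of "s - t"])
  fix x y assume "x \<in> A" "y \<in> B"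
  then have "s \<le> infdist x C" "infdist y C \<le> t" using assms by auto
  with infdist_triangle[of x C y] show "s - t \<le> dist x y" by linarith
qed (use assms in simp)

lemma hausdorff_caratheodory_closed:
  fixes C :: "'a::metric_space set"
  assumes C: "closed C"
  shows "hausdorff_outer_measure k (A \<inter> C) + hausdorff_outer_measure k (A - C) \<le> hausdorff_outer_measure k A"
proof (cases "C = {} \<or> hausdorff_outer_measure k A = top")
  case True
  then show ?thesis by auto
next
  case False
  let ?m = "hausdorff_outer_measure k :: 'a set \<Rightarrow> ennreal"
  have ne: "C \<noteq> {}" and fin: "?m A < top" using False by (auto simp: less_top)
  define B where "B n = {x \<in> A. 1 / real (Suc n) \<le> infdist x C}" for n
  define R where "R n = {x \<in> A. 1 / real (Suc (Suc n)) \<le> infdist x C \<and> infdist x C < 1 / real (Suc n)}" for n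
  have half: "(\<Sum>i<N. ?m (R (2 * i + p))) \<le> ?m A" for N p
  proof -
    have "(\<Sum>i<N. ?m (R (2 * i + p))) \<le> ?m (\<Union>i<N. R (2 * i + p))"
    proof (induction N)
      case (Suc N)
      have "(\<Sum>i<Suc N. ?m (R (2 * i + p))) \<le> ?m (\<Union>i<N. R (2 * i + p)) + ?m (R (2 * N + p))"
        using Suc by (simp add: add_right_mono)
      also have "\<dots> \<le> ?m ((\<Union>i<N. R (2 * i + p)) \<union> R (2 * N + p))"
      proof (cases "N = 0")
        case False
        show ?thesis
        proof (rule hausdorff_outer_measure_infdist)
          show "1 / real (Suc (2 * N + p)) < 1 / real (2 * N + p)"
            using False by (intro divide_strict_left_mono) auto
          show "R (2 * N + p) \<subseteq> {x. infdist x C \<le> 1 / real (Suc (2 * N + p))}"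
            by (auto simp: R_def)
          show "(\<Union>i<N. R (2 * i + p)) \<subseteq> {x. 1 / real (2 * N + p) \<le> infdist x C}"
          proof safe
            fix i x assume i: "i < N" and x: "x \<in> R (2 * i + p)"
            have "1 / real (2 * N + p) \<le> 1 / real (Suc (Suc (2 * i + p)))"
              using i by (intro divide_left_mono) auto
            also have "\<dots> \<le> infdist x C" using x by (simp add: R_def)
            finally show "1 / real (2 * N + p) \<le> infdist x C" .
          qed
        qed
      qed simp
      also have "(\<Union>i<N. R (2 * i + p)) \<union> R (2 * N + p) = (\<Union>i<Suc N. R (2 * i + p))"
        by (auto simp: lessThan_Suc)
      finally show ?case .
    qed simp
    also have "\<dots> \<le> ?m A"
      by (intro hausdorff_outer_measure_mono) (auto simp: R_def)
    finally show ?thesis .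
  qed
  have "(\<Sum>i<n. ?m (R i)) \<le> ?m A + ?m A" for n
  proof -
    have "(\<Sum>i<n. ?m (R i)) \<le> (\<Sum>i<2 * n. ?m (R i))"
      by (intro sum_mono2) auto
    also have "\<dots> = (\<Sum>i<n. ?m (R (2 * i + 0))) + (\<Sum>i<n. ?m (R (2 * i + 1)))"
      by (induction n) (auto simp: algebra_simps)
    also have "\<dots> \<le> ?m A + ?m A" by (intro add_mono half)
    finally show ?thesis .
  qed
  then have "(\<Sum>i. ?m (R i)) \<le> ?m A + ?m A"
    by (intro suminf_le_const) auto
  also have "\<dots> < top" using fin by simp
  finally have sum_fin: "(\<Sum>i. ?m (R i)) < top" .
  define g where "g i = enn2real (?m (R i))" for i
  have g: "?m (R i) = ennreal (g i)" for i
    using ennreal_suminf_lessD[OF sum_fin, of i] by (simp add: g_def)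
  have g0: "g i \<ge> 0" for i by (simp add: g_def)
  have summ: "summable g"
    using sum_fin by (intro summable_suminf_not_top) (auto simp: g g0)
  have tail: "(\<lambda>n. \<Sum>i. g (i + n)) \<longlonglongrightarrow> 0"
    using summ by (rule suminf_exist_split2)
  have main: "?m (A \<inter> C) + ?m (A - C) \<le> ?m A + ennreal (\<Sum>i. g (i + n))" for n
  proof -
    have "A - C \<subseteq> B n \<union> (\<Union>i. R (i + n))"
    proof
      fix x assume x: "x \<in> A - C"
      have pos: "infdist x C > 0"
        using x C ne in_closed_iff_infdist_zero[of C x] infdist_nonneg[of x C] by auto
      obtain q where "1 / real (Suc q) < infdist x C"
        using pos reals_Archimedean by (auto simp: inverse_eq_divide)
      then have ex: "\<exists>q. 1 / real (Suc q) \<le> infdist x C" by (intro exI[of _ q]) auto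
      define q0 where "q0 = (LEAST q. 1 / real (Suc q) \<le> infdist x C)"
      have q0: "1 / real (Suc q0) \<le> infdist x C"
        unfolding q0_def by (rule LeastI_ex[OF ex])
      have q0': "infdist x C < 1 / real (Suc q)" if "q < q0" for q
        using not_less_Least[of q "\<lambda>q. 1 / real (Suc q) \<le> infdist x C"] that
        by (auto simp: q0_def)
      show "x \<in> B n \<union> (\<Union>i. R (i + n))"
      proof (cases "q0 \<le> n")
        case True
        have "1 / real (Suc n) \<le> 1 / real (Suc q0)"
          using True by (intro divide_left_mono) auto
        with q0 x show ?thesis by (auto simp: B_def)
      next
        case False
        then obtain i where i: "q0 = Suc (i + n)"
          by (metis add.commute less_iff_Suc_add not_le)
        have "x \<in> R (i + n)" using x q0 q0'[of "i + n"] by (simp add: R_def i)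
        then show ?thesis by blast
      qed
    qed
    then have "?m (A - C) \<le> ?m (B n \<union> (\<Union>i. R (i + n)))"
      by (rule hausdorff_outer_measure_mono)
    also have "\<dots> \<le> ?m (B n) + ?m (\<Union>i. R (i + n))"
      by (rule hausdorff_outer_measure_Un_le)
    also have "\<dots> \<le> ?m (B n) + (\<Sum>i. ?m (R (i + n)))"
      by (intro add_left_mono hausdorff_outer_measure_countably_subadditive)
    also have "(\<Sum>i. ?m (R (i + n))) = ennreal (\<Sum>i. g (i + n))"
      unfolding g by (intro suminf_ennreal2 g0 summable_ignore_initial_segment summ)
    finally have "?m (A \<inter> C) + ?m (A - C) \<le> (?m (B n) + ?m (A \<inter> C)) + ennreal (\<Sum>i. g (i + n))"
      by (metis add.commute add.left_commute add_left_mono)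
    also have "?m (B n) + ?m (A \<inter> C) \<le> ?m (B n \<union> (A \<inter> C))"
      by (rule hausdorff_outer_measure_infdist[of 0 "1 / real (Suc n)" _ C]) (auto simp: B_def)
    also have "?m (B n \<union> (A \<inter> C)) \<le> ?m A"
      by (rule hausdorff_outer_measure_mono) (auto simp: B_def)
    finally show ?thesis by (simp add: add_right_mono)
  qed
  have "(\<lambda>n. ?m A + ennreal (\<Sum>i. g (i + n))) \<longlonglongrightarrow> ?m A + ennreal 0"
    by (intro tendsto_add tendsto_const tendsto_ennrealI tail)
  then have "?m (A \<inter> C) + ?m (A - C) \<le> ?m A + ennreal 0"
    by (rule LIMSEQ_le_const) (use main in auto)
  then show ?thesis by simp
qed

lemma space_hausdorff_measure [simp]: "space (hausdorff_measure k) = UNIV"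
  by (simp add: hausdorff_measure_def)

lemma sets_hausdorff_measure [simp, measurable_cong]:
  "sets (hausdorff_measure k :: 'a::metric_space measure) = sets borel"
  using sets.sigma_sets_eq[of "borel :: 'a measure"] by (simp add: hausdorff_measure_def)

theorem emeasure_hausdorff_measure:
  fixes A :: "'a::metric_space set"
  assumes "A \<in> sets borel"
  shows "emeasure (hausdorff_measure k) A = hausdorff_outer_measure k A"
proof -
  let ?m = "hausdorff_outer_measure k :: 'a set \<Rightarrow> ennreal"
  let ?L = "lambda_system UNIV (Pow UNIV) ?m"
  interpret P: sigma_algebra UNIV "Pow UNIV :: 'a set set"
    by (rule sigma_algebra_Pow)
  have ms: "measure_space UNIV ?L ?m"
    by (rule P.caratheodory_lemma) (rule outer_measure_space_hausdorff)
  have closed_L: "C \<in> ?L" if "closed C" for C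
  proof -
    have "?m (X \<inter> C) + ?m (X - C) = ?m X" for X
    proof (rule antisym)
      show "?m (X \<inter> C) + ?m (X - C) \<le> ?m X"
        using that by (rule hausdorff_caratheodory_closed)
      have "?m X = ?m ((X \<inter> C) \<union> (X - C))" by (simp add: Int_Diff_Un)
      then show "?m X \<le> ?m (X \<inter> C) + ?m (X - C)"
        using hausdorff_outer_measure_Un_le by metis
    qed
    then show ?thesis unfolding P.lambda_system_eq by simp
  qed
  have "sigma_algebra UNIV ?L" using ms by (simp add: measure_space_def)
  moreover have "Collect closed \<subseteq> ?L" using closed_L by blast
  ultimately have "sigma_sets UNIV (Collect closed) \<subseteq> ?L"
    by (rule sigma_algebra.sigma_sets_subset)
  then have sub: "sets borel \<subseteq> ?L"
    by (simp add: borel_eq_closed)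
  have "countably_additive (sets borel) ?m"
    using ms sub unfolding measure_space_def countably_additive_def by blast
  moreover have "positive (sets borel) ?m" by (simp add: positive_def)
  ultimately show ?thesis
    using assms sets.sigma_algebra_axioms[of "borel :: 'a measure"]
    by (intro emeasure_measure_of[OF hausdorff_measure_def]) auto
qed

text \<open>
  Near every boundary point, and after a rotation taking \<open>e\<close> to the last coordinate direction,
  \<open>\<Omega>\<close> is the strict epigraph of a Lipschitz function \<open>\<gamma>\<close> on the hyperplane orthogonal to \<open>e\<close>.
\<close>

definition lipschitz_domain :: "'a::euclidean_space set \<Rightarrow> bool" where
  "lipschitz_domain \<Omega> \<longleftrightarrow> open \<Omega> \<and> connected \<Omega> \<and> \<Omega> \<noteq> {} \<and>
     (\<forall>p\<in>frontier \<Omega>. \<exists>\<rho>>0. \<exists>e \<gamma> C. norm e = 1 \<and> C-lipschitz_on {z. z \<bullet> e = 0} \<gamma> \<and>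
        \<Omega> \<inter> ball p \<rho> = {x \<in> ball p \<rho>. \<gamma> (x - (x \<bullet> e) *\<^sub>R e) < x \<bullet> e})"

abbreviation surface_measure :: "'a::euclidean_space measure" where
  "surface_measure \<equiv> hausdorff_measure (DIM('a) - 1)"

definition surface_penalty ::
  "real \<Rightarrow> (real \<Rightarrow> real) \<Rightarrow> (real \<Rightarrow> real) \<Rightarrow> 'a::euclidean_space set \<Rightarrow> real \<Rightarrow> ('a \<Rightarrow> 'a) \<Rightarrow> ennreal"
where
  "surface_penalty \<beta> P g \<Omega> \<epsilon> y =
     ennreal (1 / \<epsilon> powr \<beta>) *
     (\<integral>\<^sup>+x\<in>frontier \<Omega>. (\<integral>\<^sup>+x'\<in>frontier \<Omega>.
        ennreal (1 / \<epsilon> ^ (DIM('a) - 1) * P (g (norm (x' - x)) - g (norm (y x' - y x) / \<epsilon>)))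
        \<partial>surface_measure) \<partial>surface_measure)"

definition overlap_set ::
  "'a::euclidean_space set \<Rightarrow> real \<Rightarrow> ('a \<Rightarrow> 'a) \<Rightarrow> real \<Rightarrow> 'a set" where
  "overlap_set \<Omega> \<rho> y s =
     {x \<in> frontier \<Omega>. \<exists>x'\<in>frontier \<Omega>. norm (y x - y x') \<le> s \<and> norm (x - x') > \<rho> / 2}"

definition locally_bilipschitz ::
  "'a::euclidean_space set \<Rightarrow> real \<Rightarrow> real \<Rightarrow> real \<Rightarrow> ('a \<Rightarrow> 'a) \<Rightarrow> bool" where
  "locally_bilipschitz \<Omega> \<rho> l L y \<longleftrightarrow>
     (\<forall>x1\<in>frontier \<Omega>. \<forall>x2\<in>frontier \<Omega>. norm (x1 - x2) < \<rho> \<longrightarrow>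
        l * norm (x1 - x2) \<le> norm (y x1 - y x2) \<and> norm (y x1 - y x2) \<le> L * norm (x1 - x2))"

text \<open>\<open>emeasure\<close> vanishes on non-measurable sets by convention; overlap sets are Borel.\<close>

lemma overlap_set_borel:
  fixes \<Omega> :: "'a::euclidean_space set"
  assumes "bounded \<Omega>" and y: "continuous_on (frontier \<Omega>) y"
  shows "overlap_set \<Omega> \<rho> y s \<in> sets borel"
proof -
  let ?K = "frontier \<Omega>"
  have K: "compact ?K" using assms(1) by (rule compact_frontier_bounded)
  define S where "S n = {p \<in> ?K \<times> ?K. norm (y (fst p) - y (snd p)) \<le> s \<and>
      \<rho> / 2 + 1 / real (Suc n) \<le> norm (fst p - snd p)}" for n
  have "compact (S n)" for n
  proof -
    have KK: "compact (?K \<times> ?K)" using K by (intro compact_Times)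
    have c1: "continuous_on (?K \<times> ?K) (\<lambda>p. norm (y (fst p) - y (snd p)))"
      by (intro continuous_intros continuous_on_compose2[OF y]) auto
    have c2: "continuous_on (?K \<times> ?K) (\<lambda>p. norm (fst p - snd p))"
      by (intro continuous_intros)
    have "closed ((?K \<times> ?K) \<inter> (\<lambda>p. norm (y (fst p) - y (snd p))) -` {..s})"
      by (intro continuous_closed_preimage c1 compact_imp_closed KK closed_atMost)
    moreover have "closed ((?K \<times> ?K) \<inter> (\<lambda>p. norm (fst p - snd p)) -` {\<rho> / 2 + 1 / real (Suc n)..})"
      by (intro continuous_closed_preimage c2 compact_imp_closed KK closed_atLeast)
    ultimately have "compact ((?K \<times> ?K) \<inter> (((?K \<times> ?K) \<inter> (\<lambda>p. norm (y (fst p) - y (snd p))) -` {..s})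
        \<inter> ((?K \<times> ?K) \<inter> (\<lambda>p. norm (fst p - snd p)) -` {\<rho> / 2 + 1 / real (Suc n)..})))"
      by (intro compact_Int_closed[OF KK closed_Int])
    also have "\<dots> = S n" by (auto simp: S_def)
    finally show ?thesis .
  qed
  then have "closed (fst ` S n)" for n
    by (intro compact_imp_closed compact_continuous_image continuous_intros)
  moreover have "overlap_set \<Omega> \<rho> y s = (\<Union>n. fst ` S n)"
  proof (intro equalityI subsetI)
    fix x assume "x \<in> overlap_set \<Omega> \<rho> y s"
    then obtain x' where x: "x \<in> ?K" "x' \<in> ?K" "norm (y x - y x') \<le> s" "norm (x - x') > \<rho> / 2"
      by (auto simp: overlap_set_def)
    obtain n where "1 / real (Suc n) < norm (x - x') - \<rho> / 2"
      using x(4) reals_Archimedean[of "norm (x - x') - \<rho> / 2"] by (auto simp: inverse_eq_divide)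
    then have "(x, x') \<in> S n" using x by (auto simp: S_def)
    then show "x \<in> (\<Union>n. fst ` S n)" by force
  next
    fix x assume "x \<in> (\<Union>n. fst ` S n)"
    then obtain n x' where S: "(x, x') \<in> S n" by auto
    have "1 / real (Suc n) > 0" by simp
    moreover have "\<rho> / 2 + 1 / real (Suc n) \<le> norm (x - x')" using S by (simp add: S_def)
    ultimately have "norm (x - x') > \<rho> / 2" by linarith
    moreover have "x \<in> ?K" "x' \<in> ?K" "norm (y x - y x') \<le> s" using S by (auto simp: S_def)
    ultimately have "x \<in> ?K" "x' \<in> ?K" "norm (y x - y x') \<le> s" "norm (x - x') > \<rho> / 2" by auto
    then show "x \<in> overlap_set \<Omega> \<rho> y s" by (auto simp: overlap_set_def)
  qed
  ultimately show ?thesis by auto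
qed

end

theory Submission
  imports Defs
begin

text \<open>
  Write \<open>d\<close> for the dimension and \<open>k = d - 1\<close>.  All constants come from one fact about the boundary,
  Ahlfors regularity (\<open>surface_measure_ahlfors_regular\<close>): small boundary balls of radius \<open>s\<close> have
  surface measure between two multiples of \<open>s ^ k\<close>, uniformly in the centre.

  Given this, the integrand of the penalty at \<open>(x, x')\<close> is positive only if \<open>y\<close> shrinks the distance
  of the two points by more than the factor \<open>\<epsilon>\<close>.  For \<open>\<epsilon> \<le> l\<close> the local bi-Lipschitz bound excludes
  this for close points, so \<open>x\<close> is then an overlap point, and for each \<open>x\<close> the points \<open>x'\<close> in question
  form boundedly many clusters of radius of order \<open>\<epsilon>\<close>.  Their measure of order \<open>\<epsilon> ^ k\<close> cancels the
  prefactor, and the inner integral is bounded (\<open>scaled_penalty_le\<close>).  Conversely, if \<open>x\<close> overlaps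
  with a distant \<open>x'\<close> at scale \<open>r * \<epsilon>\<close>, the same is nearly true of all boundary points in a ball of
  radius of order \<open>\<epsilon>\<close> about \<open>x'\<close>, so the integrand is bounded below there, and so is the inner integral
  (\<open>scaled_penalty_ge\<close>).  Integration over \<open>x\<close> gives both inequalities.

  Regularity is local, and locally the boundary is a Lipschitz graph over a hyperplane.  The upper
  bound (\<open>hausdorff_outer_measure_graph_le\<close>) covers the graph by the pieces above small cubes.  The
  lower bound (\<open>hausdorff_outer_measure_graph_ge\<close>) has to control arbitrary covers, and does so by
  comparison with Lebesgue measure: translating the sets of a cover along a segment transversal to the
  graph fills a ball, whose volume is known.
\<close>

section \<open>The boundary of a Lipschitz domain as a graph\<close>

definition hyperplane_proj :: "'a::euclidean_space \<Rightarrow> 'a \<Rightarrow> 'a" where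
  "hyperplane_proj e x = x - (x \<bullet> e) *\<^sub>R e"

lemma inner_hyperplane_proj: "norm e = 1 \<Longrightarrow> hyperplane_proj e x \<bullet> e = 0"
  by (simp add: hyperplane_proj_def inner_diff_left norm_eq_1)

lemma hyperplane_proj_diff: "hyperplane_proj e (x - y) = hyperplane_proj e x - hyperplane_proj e y"
  by (simp add: hyperplane_proj_def algebra_simps inner_diff_left)

lemma hyperplane_proj_add_scaleR: "norm e = 1 \<Longrightarrow> hyperplane_proj e (x + t *\<^sub>R e) = hyperplane_proj e x"
  by (simp add: hyperplane_proj_def algebra_simps inner_add_left norm_eq_1)

lemma norm_hyperplane_proj_le:
  assumes "norm e = 1"
  shows "norm (hyperplane_proj e x) \<le> norm x"
proof -
  have "(norm (hyperplane_proj e x))\<^sup>2 = (norm x)\<^sup>2 - (x \<bullet> e)\<^sup>2"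
    using assms unfolding hyperplane_proj_def power2_norm_eq_inner norm_eq_1
    by (simp add: inner_diff_left inner_diff_right inner_commute power2_eq_square algebra_simps)
  then have "(norm (hyperplane_proj e x))\<^sup>2 \<le> (norm x)\<^sup>2" by simp
  then show ?thesis by (rule power2_le_imp_le) simp
qed

lemma continuous_on_hyperplane_proj: "continuous_on A (hyperplane_proj e)"
  unfolding hyperplane_proj_def by (intro continuous_intros)

text \<open>
  Points strictly below the graph are exterior because \<open>\<gamma>\<close> is continuous; points on the graph are
  limits of domain points because moving up along \<open>e\<close> leaves the projection unchanged.
\<close>

lemma lipschitz_domain_frontier_chart:
  fixes \<Omega> :: "'a::euclidean_space set"
  assumes \<Omega>: "lipschitz_domain \<Omega>" and p: "p \<in> frontier \<Omega>"
  obtains \<rho> e \<gamma> C where "\<rho> > 0" "norm e = 1" "C-lipschitz_on {z. z \<bullet> e = 0} \<gamma>"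
    "\<And>x. x \<in> ball p \<rho> \<Longrightarrow> x \<in> frontier \<Omega> \<longleftrightarrow> \<gamma> (hyperplane_proj e x) = x \<bullet> e"
proof -
  from \<Omega> p obtain \<rho> e \<gamma> C where \<rho>: "\<rho> > 0" and e: "norm e = 1"
    and lip: "C-lipschitz_on {z. z \<bullet> e = 0} \<gamma>"
    and gr: "\<Omega> \<inter> ball p \<rho> = {x \<in> ball p \<rho>. \<gamma> (x - (x \<bullet> e) *\<^sub>R e) < x \<bullet> e}"
    unfolding lipschitz_domain_def by blast
  have op: "open \<Omega>" using \<Omega> by (simp add: lipschitz_domain_def)
  have gr': "x \<in> \<Omega> \<longleftrightarrow> \<gamma> (hyperplane_proj e x) < x \<bullet> e" if "x \<in> ball p \<rho>" for x
    using gr that unfolding hyperplane_proj_def by blast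
  have cont: "continuous_on UNIV (\<lambda>x. \<gamma> (hyperplane_proj e x))"
    by (rule continuous_on_compose2[OF lipschitz_on_continuous_on[OF lip] continuous_on_hyperplane_proj])
       (use inner_hyperplane_proj[OF e] in auto)
  have "x \<in> frontier \<Omega> \<longleftrightarrow> \<gamma> (hyperplane_proj e x) = x \<bullet> e" if x: "x \<in> ball p \<rho>" for x
  proof
    assume "x \<in> frontier \<Omega>"
    then have xc: "x \<in> closure \<Omega>" and xn: "x \<notin> \<Omega>" using op by (auto simp: frontier_def interior_open)
    have "\<not> x \<bullet> e < \<gamma> (hyperplane_proj e x)"
    proof
      assume lt: "x \<bullet> e < \<gamma> (hyperplane_proj e x)"
      define T where "T = ball p \<rho> \<inter> {z. z \<bullet> e < \<gamma> (hyperplane_proj e z)}"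
      have "open T" unfolding T_def
        by (intro open_Int open_ball open_Collect_less cont continuous_intros)
      moreover have "x \<in> T" using x lt by (simp add: T_def)
      ultimately have "\<Omega> \<inter> T \<noteq> {}"
        using xc by (metis IntI closure_iff_nhds_not_empty empty_iff inf_commute order_refl)
      then obtain z where "z \<in> \<Omega>" "z \<in> ball p \<rho>" "z \<bullet> e < \<gamma> (hyperplane_proj e z)"
        by (auto simp: T_def)
      with gr'[of z] show False by auto
    qed
    with gr'[OF x] xn show "\<gamma> (hyperplane_proj e x) = x \<bullet> e" by simp
  next
    assume eq: "\<gamma> (hyperplane_proj e x) = x \<bullet> e"
    have "x \<notin> \<Omega>" using gr'[OF x] eq by simp
    moreover have "x \<in> closure \<Omega>"
      unfolding closure_approachable
    proof (intro allI impI)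
      fix \<eta> :: real assume \<eta>: "\<eta> > 0"
      define t where "t = min (\<eta> / 2) ((\<rho> - dist p x) / 2)"
      have t: "t > 0" "t < \<eta>" "t < \<rho> - dist p x" using \<eta> x by (auto simp: t_def min_less_iff_disj)
      have "dist p (x + t *\<^sub>R e) \<le> dist p x + t"
        using dist_triangle[of p "x + t *\<^sub>R e" x] t e by (simp add: dist_norm)
      then have "x + t *\<^sub>R e \<in> ball p \<rho>" using t by simp
      moreover have "\<gamma> (hyperplane_proj e (x + t *\<^sub>R e)) < (x + t *\<^sub>R e) \<bullet> e"
        using e eq t by (simp add: hyperplane_proj_add_scaleR inner_add_left norm_eq_1)
      ultimately have "x + t *\<^sub>R e \<in> \<Omega>" using gr' by blast
      moreover have "dist (x + t *\<^sub>R e) x < \<eta>" using t e by (simp add: dist_norm)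
      ultimately show "\<exists>y\<in>\<Omega>. dist y x < \<eta>" by blast
    qed
    ultimately show "x \<in> frontier \<Omega>" using op by (simp add: frontier_def interior_open)
  qed
  with \<rho> e lip show thesis by (rule that)
qed

section \<open>Lower bound for the measure of a Lipschitz graph\<close>

text \<open>
  Taking the closure makes the sweep of an arbitrary covering set compact, hence measurable.
\<close>

definition segment_sweep :: "'a::euclidean_space \<Rightarrow> real \<Rightarrow> 'a set \<Rightarrow> 'a set" where
  "segment_sweep e s U = (\<lambda>(u, t). u + t *\<^sub>R e) ` (closure U \<times> {0..s})"

lemma segment_sweepI: "u \<in> U \<Longrightarrow> 0 \<le> t \<Longrightarrow> t \<le> s \<Longrightarrow> u + t *\<^sub>R e \<in> segment_sweep e s U"
  unfolding segment_sweep_def using closure_subset[of U] by force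

lemma compact_segment_sweep: "bounded U \<Longrightarrow> compact (segment_sweep e s U)"
  unfolding segment_sweep_def split_def
  by (intro compact_continuous_image continuous_intros compact_Times) auto

text \<open>
  The sweep is a tube of length \<open>s\<close> and width at most \<open>r\<close>, so about \<open>s / r\<close> balls of radius \<open>2 * r\<close>
  cover it.  The radius \<open>r\<close> is separate from the diameter since the latter may vanish.
\<close>

lemma emeasure_segment_sweep_le_aux:
  fixes U :: "'a::euclidean_space set"
  assumes U: "bounded U" "U \<noteq> {}" "diameter U \<le> r" and r: "0 < r" "r \<le> s" and e: "norm e = 1"
  shows "emeasure lborel (segment_sweep e s U)
    \<le> ennreal (2 ^ (DIM('a) + 1) * unit_ball_vol (real DIM('a)) * s * r ^ (DIM('a) - 1))"
proof -
  obtain u where u: "u \<in> U" using U by blast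
  define N where "N = nat \<lfloor>s / r\<rfloor>"
  have N: "real N \<le> s / r" using r by (simp add: N_def)
  have sub: "segment_sweep e s U \<subseteq> (\<Union>j\<in>{..N}. cball (u + (real j * r) *\<^sub>R e) (2 * r))"
  proof
    fix w assume "w \<in> segment_sweep e s U"
    then obtain v t where v: "v \<in> closure U" and t: "0 \<le> t" "t \<le> s" and w: "w = v + t *\<^sub>R e"
      by (auto simp: segment_sweep_def)
    define j where "j = nat \<lfloor>t / r\<rfloor>"
    have tr: "t / r \<ge> 0" using t r by simp
    have j: "real j \<le> t / r" "t / r < real j + 1" unfolding j_def using tr by linarith+
    have "j \<le> N" unfolding j_def N_def using t r by (intro nat_mono floor_mono divide_right_mono) auto
    have jr: "real j * r \<le> t" "t \<le> real j * r + r" using j r by (simp_all add: field_simps)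
    have "dist u v \<le> diameter U"
      using diameter_bounded_bound[of "closure U" u v] U u v closure_subset[of U]
      by (auto simp: diameter_closure)
    then have uv: "norm (u - v) \<le> r" using U by (simp add: dist_norm)
    have "u + (real j * r) *\<^sub>R e - w = (u - v) + (real j * r - t) *\<^sub>R e"
      by (simp add: w algebra_simps)
    then have "dist (u + (real j * r) *\<^sub>R e) w \<le> norm (u - v) + norm ((real j * r - t) *\<^sub>R e)"
      unfolding dist_norm by (metis norm_triangle_ineq)
    also have "\<dots> \<le> r + r" using uv jr e by (intro add_mono) auto
    finally have "w \<in> cball (u + (real j * r) *\<^sub>R e) (2 * r)" by simp
    with \<open>j \<le> N\<close> show "w \<in> (\<Union>j\<in>{..N}. cball (u + (real j * r) *\<^sub>R e) (2 * r))" by blast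
  qed
  have "emeasure lborel (segment_sweep e s U) \<le> emeasure lborel (\<Union>j\<in>{..N}. cball (u + (real j * r) *\<^sub>R e) (2 * r))"
    by (intro emeasure_mono sub) auto
  also have "\<dots> \<le> (\<Sum>j\<in>{..N}. emeasure lborel (cball (u + (real j * r) *\<^sub>R e) (2 * r)))"
    by (intro emeasure_subadditive_finite) auto
  also have "\<dots> = (\<Sum>j\<in>{..N}. ennreal (unit_ball_vol (real DIM('a)) * (2 * r) ^ DIM('a)))"
    using r by (intro sum.cong refl emeasure_cball) auto
  also have "\<dots> = ennreal ((real N + 1) * (unit_ball_vol (real DIM('a)) * (2 * r) ^ DIM('a)))"
    using r by (subst sum_ennreal) (auto simp: ac_simps)
  also have "\<dots> \<le> ennreal ((2 * (s / r)) * (unit_ball_vol (real DIM('a)) * (2 * r) ^ DIM('a)))"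
  proof (intro ennreal_leI mult_right_mono)
    have "1 \<le> s / r" using r by simp
    with N show "real N + 1 \<le> 2 * (s / r)" by simp
  qed (use r in auto)
  also have "(2 * (s / r)) * (unit_ball_vol (real DIM('a)) * (2 * r) ^ DIM('a))
     = 2 ^ (DIM('a) + 1) * unit_ball_vol (real DIM('a)) * s * r ^ (DIM('a) - 1)"
  proof -
    obtain k where k: "DIM('a) = Suc k" using DIM_positive[where 'a='a] gr0_implies_Suc by blast
    show ?thesis unfolding k using r by (simp add: power_mult_distrib)
  qed
  finally show ?thesis .
qed

text \<open>
  The limit of the preceding bound as \<open>r\<close> decreases to the diameter.  Volume in dimension \<open>d\<close> of the
  sweep is thereby compared with the \<open>(d - 1)\<close>-dimensional weight of the set being swept.
\<close>

lemma emeasure_segment_sweep_le: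
  fixes U :: "'a::euclidean_space set"
  assumes U: "bounded U" "diameter U < s" and e: "norm e = 1"
  shows "emeasure lborel (segment_sweep e s U)
    \<le> ennreal (2 ^ (2 * DIM('a)) * unit_ball_vol (real DIM('a)) / unit_ball_vol (real (DIM('a) - 1)) * s)
      * hausdorff_weight (DIM('a) - 1) U"
proof (cases "U = {}")
  case True
  then show ?thesis by (simp add: segment_sweep_def)
next
  case False
  let ?D = "DIM('a)"
  let ?M = "2 ^ (?D + 1) * unit_ball_vol (real ?D) * s"
  have d0: "diameter U \<ge> 0" using U by (intro diameter_ge_0)
  have ev: "eventually (\<lambda>n. diameter U + 1 / real (Suc n) < s) sequentially"
  proof -
    have "(\<lambda>n. diameter U + 1 / real (Suc n)) \<longlonglongrightarrow> diameter U + 0"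
      by (intro tendsto_intros LIMSEQ_Suc[OF lim_1_over_n])
    from order_tendstoD(2)[OF this, of s] show ?thesis using U by simp
  qed
  have "emeasure lborel (segment_sweep e s U) \<le> ennreal (?M * (diameter U) ^ (?D - 1))"
  proof (rule tendsto_lowerbound)
    have "(\<lambda>n. ?M * (diameter U + 1 / real (Suc n)) ^ (?D - 1)) \<longlonglongrightarrow> ?M * (diameter U + 0) ^ (?D - 1)"
      by (intro tendsto_intros LIMSEQ_Suc[OF lim_1_over_n])
    then show "(\<lambda>n. ennreal (?M * (diameter U + 1 / real (Suc n)) ^ (?D - 1)))
        \<longlonglongrightarrow> ennreal (?M * (diameter U) ^ (?D - 1))"
      by (intro tendsto_ennrealI) simp
    show "\<forall>\<^sub>F n in sequentially. emeasure lborel (segment_sweep e s U)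
        \<le> ennreal (?M * (diameter U + 1 / real (Suc n)) ^ (?D - 1))"
      using ev
    proof eventually_elim
      case (elim n)
      show ?case
        using elim d0 by (intro emeasure_segment_sweep_le_aux U False e) (auto intro: add_nonneg_pos)
    qed
  qed simp
  also have "?M * (diameter U) ^ (?D - 1) =
     (2 ^ (2 * ?D) * unit_ball_vol (real ?D) / unit_ball_vol (real (?D - 1)) * s)
      * (unit_ball_vol (real (?D - 1)) * (diameter U / 2) ^ (?D - 1))"
  proof -
    obtain k where k: "DIM('a) = Suc k" using DIM_positive[where 'a='a] gr0_implies_Suc by blast
    have "unit_ball_vol (real k) \<noteq> 0" using unit_ball_vol_pos[of "real k"] by linarith
    then show ?thesis unfolding k by (simp add: power_divide power_add[symmetric] field_simps flip: mult_2 power_mult)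
  qed
  also have "ennreal \<dots> = ennreal (2 ^ (2 * ?D) * unit_ball_vol (real ?D) / unit_ball_vol (real (?D - 1)) * s)
      * hausdorff_weight (?D - 1) U"
    unfolding hausdorff_weight_def using False U d0
    by (subst ennreal_mult) auto
  finally show ?thesis .
qed

text \<open>
  Sweeping the piece of the graph in a ball of radius \<open>s\<close> upwards by \<open>s\<close> produces a solid set that
  contains a ball of radius comparable to \<open>s\<close>.  The sweeps of the members of any fine cover of the
  piece therefore have total volume at least of order \<open>s ^ d\<close>, while each sweep has volume at most of
  order \<open>s\<close> times the weight of its member.  Dividing by \<open>s\<close> gives the bound for every such cover.
\<close>

lemma hausdorff_outer_measure_graph_ge:
  fixes K :: "'a::euclidean_space set"
  assumes e: "norm e = 1" and lip: "C-lipschitz_on {z. z \<bullet> e = 0} \<gamma>"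
    and x: "\<gamma> (hyperplane_proj e x) = x \<bullet> e" and s: "0 < s"
    and gr: "\<And>z. z \<in> cball x s \<Longrightarrow> \<gamma> (hyperplane_proj e z) = z \<bullet> e \<Longrightarrow> z \<in> K"
  shows "ennreal (unit_ball_vol (real (DIM('a) - 1)) / (16 * (1 + C)) ^ DIM('a) * s ^ (DIM('a) - 1))
    \<le> hausdorff_outer_measure (DIM('a) - 1) (K \<inter> cball x s)"
proof -
  let ?D = "DIM('a)"
  let ?ub = "unit_ball_vol (real (?D - 1))"
  have C: "C \<ge> 0" using lip by (rule lipschitz_on_nonneg)
  \<comment> \<open>small enough that the vertical and horizontal errors below add up to at most \<open>s / 4\<close>\<close>
  define \<kappa> where "\<kappa> = 1 / (4 * (1 + C))"
  have \<kappa>: "\<kappa> > 0" "(1 + C) * \<kappa> = 1 / 4" using C by (auto simp: \<kappa>_def field_simps)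
  define M where "M = 2 ^ (2 * ?D) * unit_ball_vol (real ?D) / ?ub"
  have M: "M > 0" by (simp add: M_def)
  define q where "q = x + (s / 2) *\<^sub>R e"
  \<comment> \<open>a point \<open>w\<close> of the small ball lies above the graph point \<open>v\<close> with the same projection\<close>
  have fat: "\<exists>v t. v \<in> K \<inter> cball x s \<and> 0 \<le> t \<and> t \<le> s \<and> w = v + t *\<^sub>R e" if w: "w \<in> cball q (\<kappa> * s)" for w
  proof -
    let ?h = "\<gamma> (hyperplane_proj e w)"
    define v where "v = hyperplane_proj e w + ?h *\<^sub>R e"
    define t where "t = w \<bullet> e - ?h"
    have wv: "w = v + t *\<^sub>R e" by (simp add: v_def t_def hyperplane_proj_def algebra_simps)
    have qw: "norm (w - q) \<le> \<kappa> * s" using w by (simp add: dist_norm norm_minus_commute)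
    have "hyperplane_proj e w - hyperplane_proj e x = hyperplane_proj e (w - q)"
      using e by (simp add: q_def hyperplane_proj_diff hyperplane_proj_add_scaleR)
    then have pd: "norm (hyperplane_proj e w - hyperplane_proj e x) \<le> \<kappa> * s"
      using norm_hyperplane_proj_le[OF e, of "w - q"] qw by simp
    have "dist ?h (\<gamma> (hyperplane_proj e x)) \<le> C * dist (hyperplane_proj e w) (hyperplane_proj e x)"
      using lipschitz_onD[OF lip] inner_hyperplane_proj[OF e] by blast
    also have "\<dots> \<le> C * (\<kappa> * s)" using pd C by (intro mult_left_mono) (auto simp: dist_norm)
    finally have hd: "\<bar>?h - x \<bullet> e\<bar> \<le> C * (\<kappa> * s)" using x by (simp add: dist_real_def)
    have k4: "\<kappa> * s + C * (\<kappa> * s) = s / 4"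
    proof -
      have "\<kappa> * s + C * (\<kappa> * s) = ((1 + C) * \<kappa>) * s" by (simp add: algebra_simps)
      then show ?thesis unfolding \<kappa>(2) by simp
    qed
    have "v - x = (hyperplane_proj e w - hyperplane_proj e x) + (?h - x \<bullet> e) *\<^sub>R e"
      by (simp add: v_def hyperplane_proj_def algebra_simps)
    then have "norm (v - x) \<le> norm (hyperplane_proj e w - hyperplane_proj e x) + norm ((?h - x \<bullet> e) *\<^sub>R e)"
      by (metis norm_triangle_ineq)
    also have "\<dots> \<le> \<kappa> * s + C * (\<kappa> * s)" using pd hd e by (intro add_mono) auto
    also have "\<dots> \<le> s" using k4 s by simp
    finally have vs: "v \<in> cball x s" by (simp add: dist_norm norm_minus_commute)
    have pv: "hyperplane_proj e v = hyperplane_proj e w"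
      using e wv hyperplane_proj_add_scaleR by metis
    have "v \<bullet> e = ?h" using e inner_hyperplane_proj[OF e, of w] by (simp add: v_def inner_add_left norm_eq_1)
    with pv vs have vK: "v \<in> K" by (intro gr) auto
    have "\<bar>(w - q) \<bullet> e\<bar> \<le> norm (w - q) * norm e" by (rule Cauchy_Schwarz_ineq2)
    then have "\<bar>w \<bullet> e - x \<bullet> e - s / 2\<bar> \<le> \<kappa> * s"
      using e qw by (simp add: q_def inner_diff_left inner_add_left norm_eq_1 algebra_simps)
    with hd k4 have "\<bar>t - s / 2\<bar> \<le> s / 4" unfolding t_def by linarith
    then have "0 \<le> t" "t \<le> s" using s by linarith+
    with vs vK wv show ?thesis by blast
  qed
  have "ennreal (?ub / (16 * (1 + C)) ^ ?D * s ^ (?D - 1)) \<le> hausdorff_premeasure (?D - 1) (s / 2) (K \<inter> cball x s)"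
    unfolding hausdorff_premeasure_def
  proof (rule INF_greatest)
    fix U assume U: "U \<in> hausdorff_covers (s / 2) (K \<inter> cball x s)"
    have *: "emeasure lborel (cball q (\<kappa> * s)) \<le> ennreal (M * s) * (\<Sum>i. hausdorff_weight (?D - 1) (U i))"
    proof -
      have Ub: "bounded (U i)" and Ud': "diameter (U i) \<le> s / 2" for i
        using U by (auto simp: hausdorff_covers_def)
      have Ud: "diameter (U i) < s" for i using Ud'[of i] s by linarith
      have "cball q (\<kappa> * s) \<subseteq> (\<Union>i. segment_sweep e s (U i))"
      proof
        fix w assume "w \<in> cball q (\<kappa> * s)"
        then obtain v t where v: "v \<in> K \<inter> cball x s" "0 \<le> t" "t \<le> s" "w = v + t *\<^sub>R e"
          using fat by blast
        then obtain i where "v \<in> U i" using U by (auto simp: hausdorff_covers_def)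
        then show "w \<in> (\<Union>i. segment_sweep e s (U i))" using v by (auto intro: segment_sweepI)
      qed
      then have "emeasure lborel (cball q (\<kappa> * s)) \<le> emeasure lborel (\<Union>i. segment_sweep e s (U i))"
        using compact_segment_sweep[OF Ub] by (intro emeasure_mono) (auto intro!: sets.countable_UN simp: borel_compact)
      also have "\<dots> \<le> (\<Sum>i. emeasure lborel (segment_sweep e s (U i)))"
        using compact_segment_sweep[OF Ub] by (intro emeasure_subadditive_countably) (auto simp: borel_compact)
      also have "\<dots> \<le> (\<Sum>i. ennreal (M * s) * hausdorff_weight (?D - 1) (U i))"
        unfolding M_def by (intro suminf_le emeasure_segment_sweep_le Ub Ud e) auto
      finally show ?thesis by simp
    qed
    have "ennreal (M * s) * ennreal (?ub / (16 * (1 + C)) ^ ?D * s ^ (?D - 1)) = emeasure lborel (cball q (\<kappa> * s))"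
    proof -
      obtain k where k: "DIM('a) = Suc k" using DIM_positive[where 'a='a] gr0_implies_Suc by blast
      define X where "X = (4 * (1 + C)) ^ Suc k"
      define Y where "Y = (4::real) ^ Suc k"
      have XY: "X \<noteq> 0" "Y \<noteq> 0" using C by (auto simp: X_def Y_def)
      have 16: "(16 * (1 + C)) ^ Suc k = Y * X"
        unfolding X_def Y_def power_mult_distrib[symmetric] by simp
      have 4: "(2::real) ^ (2 * Suc k) = Y" unfolding Y_def power_mult by simp
      have \<kappa>s: "(\<kappa> * s) ^ Suc k = 1 / X * (s * s ^ k)"
        unfolding \<kappa>_def X_def power_mult_distrib[of _ s] power_one_over by simp
      have "unit_ball_vol (real k) \<noteq> 0" using unit_ball_vol_pos[of "real k"] by linarith
      then have "M * s * (?ub / (16 * (1 + C)) ^ ?D * s ^ (?D - 1)) = unit_ball_vol (real ?D) * (\<kappa> * s) ^ ?D"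
        unfolding M_def k 16 4 \<kappa>s using XY by simp
      then show ?thesis
        using s \<kappa> M C by (subst emeasure_cball) (auto simp: ennreal_mult[symmetric])
    qed
    also note *
    finally show "ennreal (?ub / (16 * (1 + C)) ^ ?D * s ^ (?D - 1)) \<le> (\<Sum>i. hausdorff_weight (?D - 1) (U i))"
      using M s by (subst (asm) ennreal_mult_le_mult_iff) auto
  qed
  also have "\<dots> \<le> hausdorff_outer_measure (?D - 1) (K \<inter> cball x s)"
    unfolding hausdorff_outer_measure_def using s by (intro SUP_upper) auto
  finally show ?thesis .
qed


section \<open>Upper bound for the measure of a Lipschitz graph\<close>

lemma hausdorff_premeasure_finite_cover_le:
  assumes I: "finite I" and cov: "A \<subseteq> (\<Union>i\<in>I. Q i)"
    and Q: "\<And>i. i \<in> I \<Longrightarrow> bounded (Q i) \<and> diameter (Q i) \<le> \<eta>" and \<eta>: "0 \<le> \<eta>" "\<eta> \<le> \<delta>"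
  shows "hausdorff_premeasure k \<delta> A \<le> ennreal (real (card I) * (unit_ball_vol (real k) * (\<eta> / 2) ^ k))"
proof -
  obtain h where h: "bij_betw h {0..<card I} I" using ex_bij_betw_nat_finite[OF I] by blast
  define U where "U i = (if i < card I then Q (h i) else {})" for i
  have hI: "h i \<in> I" if "i < card I" for i using bij_betwE[OF h] that by simp
  have "U \<in> hausdorff_covers \<delta> A"
  proof -
    have "x \<in> (\<Union>i. U i)" if x: "x \<in> A" for x
    proof -
      obtain j where "j \<in> I" "x \<in> Q j" using x cov by blast
      moreover then obtain i where "i < card I" "h i = j"
        using h unfolding bij_betw_def by (metis atLeastLessThan_iff imageE)
      ultimately show ?thesis by (auto simp: U_def intro!: exI[of _ i])
    qed
    moreover have "bounded (U i) \<and> diameter (U i) \<le> \<delta>" for i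
      using Q[OF hI] \<eta> by (auto simp: U_def intro: order_trans)
    ultimately show ?thesis by (auto simp: hausdorff_covers_def)
  qed
  then have "hausdorff_premeasure k \<delta> A \<le> (\<Sum>i. hausdorff_weight k (U i))"
    unfolding hausdorff_premeasure_def by (rule INF_lower)
  also have "\<dots> = (\<Sum>i<card I. hausdorff_weight k (U i))"
    by (rule suminf_finite) (auto simp: U_def)
  also have "\<dots> \<le> (\<Sum>i<card I. ennreal (unit_ball_vol (real k) * (\<eta> / 2) ^ k))"
  proof (rule sum_mono)
    fix i assume "i \<in> {..<card I}"
    then have "bounded (U i)" "diameter (U i) \<le> \<eta>" using Q[OF hI] by (auto simp: U_def)
    then show "hausdorff_weight k (U i) \<le> ennreal (unit_ball_vol (real k) * (\<eta> / 2) ^ k)"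
      unfolding hausdorff_weight_def
      by (auto intro!: ennreal_leI mult_left_mono power_mono diameter_ge_0)
  qed
  also have "\<dots> = ennreal (real (card I) * (unit_ball_vol (real k) * (\<eta> / 2) ^ k))"
    using \<eta> by (subst sum_ennreal) auto
  finally show ?thesis .
qed

lemma hyperplane_orthonormal_basis:
  fixes e :: "'a::euclidean_space"
  assumes e: "norm e = 1"
  obtains B where "finite B" "card B = DIM('a) - 1" "\<And>b. b \<in> B \<Longrightarrow> norm b = 1" "\<And>b. b \<in> B \<Longrightarrow> b \<bullet> e = 0"
    "\<And>x. hyperplane_proj e x = (\<Sum>b\<in>B. (x \<bullet> b) *\<^sub>R b)"
proof -
  have sub: "subspace {z. e \<bullet> z = 0}" by (rule subspace_hyperplane)
  obtain B where B: "B \<subseteq> {z. e \<bullet> z = 0}" "pairwise orthogonal B" "\<And>x. x \<in> B \<Longrightarrow> norm x = 1"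
      "independent B" "card B = dim {z. e \<bullet> z = 0}" "span B = {z. e \<bullet> z = 0}"
    using orthonormal_basis_subspace[OF sub] by blast
  have fin: "finite B" using B(4) by (rule independent_imp_finite)
  have "e \<noteq> 0" using e by auto
  then have "card B = DIM('a) - 1" using B(5) dim_hyperplane by metis
  moreover have be: "b \<bullet> e = 0" if "b \<in> B" for b using B(1) that by (auto simp: inner_commute)
  moreover have "hyperplane_proj e x = (\<Sum>b\<in>B. (x \<bullet> b) *\<^sub>R b)" for x
  proof -
    have "hyperplane_proj e x \<in> span B"
      unfolding B(6) using inner_hyperplane_proj[OF e, of x] by (simp add: inner_commute)
    then have "(\<Sum>b\<in>B. (hyperplane_proj e x \<bullet> b) *\<^sub>R b) = hyperplane_proj e x"
      using B fin by (intro orthonormal_basis_expand) auto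
    moreover have "hyperplane_proj e x \<bullet> b = x \<bullet> b" if "b \<in> B" for b
      using be[OF that] by (simp add: hyperplane_proj_def inner_diff_left inner_commute[of e])
    ultimately show ?thesis by simp
  qed
  ultimately show thesis using that fin B(3) by blast
qed

text \<open>
  Orthonormal coordinates of the hyperplane cut the projection of \<open>A\<close> into at most \<open>(n + 1) ^ k\<close> cubes
  of side \<open>2 * s / n\<close>, where \<open>k\<close> is the dimension of the hyperplane.  Since the height is Lipschitz in
  the projection, the piece of \<open>A\<close> above a cube has diameter of order \<open>s / n\<close>, so the weights of the
  pieces add up to a multiple of \<open>s ^ k\<close> independent of \<open>n\<close>; a large \<open>n\<close> serves every mesh size.
\<close>

lemma hausdorff_outer_measure_graph_le:
  fixes A :: "'a::euclidean_space set"
  assumes e: "norm e = 1" and lip: "C-lipschitz_on {z. z \<bullet> e = 0} \<gamma>"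
    and gr: "\<And>z. z \<in> A \<Longrightarrow> \<gamma> (hyperplane_proj e z) = z \<bullet> e"
    and A: "A \<subseteq> cball x s" and s: "0 < s"
  shows "hausdorff_outer_measure (DIM('a) - 1) A
    \<le> ennreal (unit_ball_vol (real (DIM('a) - 1)) * (2 * ((1 + C) * real (DIM('a) - 1))) ^ (DIM('a) - 1)
         * s ^ (DIM('a) - 1))"
  unfolding hausdorff_outer_measure_def
proof (rule SUP_least)
  let ?k = "DIM('a) - 1"
  let ?ub = "unit_ball_vol (real ?k)"
  have C: "C \<ge> 0" using lip by (rule lipschitz_on_nonneg)
  fix \<delta> :: real assume "\<delta> \<in> {0<..}"
  then have \<delta>: "\<delta> > 0" by simp
  obtain B where B: "finite B" "card B = ?k" "\<And>b. b \<in> B \<Longrightarrow> norm b = 1"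
    and pB: "\<And>x. hyperplane_proj e x = (\<Sum>b\<in>B. (x \<bullet> b) *\<^sub>R b)"
    using hyperplane_orthonormal_basis[OF e] by metis
  let ?D = "(1 + C) * (real ?k * (2 * s))"
  \<comment> \<open>\<open>?D / n\<close> will bound the diameter of a piece, so it has to be at most \<open>\<delta>\<close>\<close>
  define n where "n = Suc (nat \<lceil>?D / \<delta>\<rceil>)"
  have n: "real n \<ge> 1" "?D / \<delta> \<le> real n" unfolding n_def by linarith+
  define \<eta> where "\<eta> = ?D / real n"
  have \<eta>: "0 \<le> \<eta>" "\<eta> \<le> \<delta>"
  proof -
    have "?D \<ge> 0" using s C by (intro mult_nonneg_nonneg) auto
    then show "0 \<le> \<eta>" by (simp add: \<eta>_def)
    have "?D \<le> real n * \<delta>" using n(2) \<delta> by (simp only: pos_divide_le_eq)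
    then show "\<eta> \<le> \<delta>" unfolding \<eta>_def using n(1) by (subst pos_divide_le_eq) (auto simp: mult.commute)
  qed
  define cell where "cell z b = nat \<lfloor>((z - x) \<bullet> b + s) * real n / (2 * s)\<rfloor>" for z b
  define I where "I = PiE B (\<lambda>_. {0..n})"
  define Q where "Q f = {z \<in> A. \<forall>b\<in>B. cell z b = f b}" for f
  have co: "0 \<le> ((z - x) \<bullet> b + s) * real n / (2 * s)" "((z - x) \<bullet> b + s) * real n / (2 * s) \<le> real n"
    if "z \<in> A" "b \<in> B" for z b
  proof -
    have "\<bar>(z - x) \<bullet> b\<bar> \<le> norm (z - x) * norm b" by (rule Cauchy_Schwarz_ineq2)
    also have "\<dots> \<le> s" using that A B(3) by (auto simp: dist_norm norm_minus_commute)
    finally have "0 \<le> (z - x) \<bullet> b + s" "(z - x) \<bullet> b + s \<le> 2 * s" by linarith+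
    then show "0 \<le> ((z - x) \<bullet> b + s) * real n / (2 * s)" using s by (intro divide_nonneg_pos mult_nonneg_nonneg) auto
    have "((z - x) \<bullet> b + s) * real n \<le> 2 * s * real n"
      using \<open>(z - x) \<bullet> b + s \<le> 2 * s\<close> by (intro mult_right_mono) auto
    then show "((z - x) \<bullet> b + s) * real n / (2 * s) \<le> real n"
      using s by (subst pos_divide_le_eq) (auto simp: mult.commute)
  qed
  have "hausdorff_premeasure ?k \<delta> A \<le> ennreal (real (card I) * (?ub * (\<eta> / 2) ^ ?k))"
  proof (rule hausdorff_premeasure_finite_cover_le[where Q = Q])
    show "finite I" unfolding I_def using B by (intro finite_PiE) auto
    show "A \<subseteq> (\<Union>f\<in>I. Q f)"
    proof
      fix z assume z: "z \<in> A"
      have "cell z b \<le> n" if "b \<in> B" for b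
        using co[OF z that] unfolding cell_def by linarith
      then have "restrict (cell z) B \<in> I" by (auto simp: I_def)
      moreover have "z \<in> Q (restrict (cell z) B)" using z by (simp add: Q_def)
      ultimately show "z \<in> (\<Union>f\<in>I. Q f)" by blast
    qed
    fix f
    have "bounded (Q f)" by (rule bounded_subset[OF bounded_cball, of _ x s]) (use A in \<open>auto simp: Q_def\<close>)
    moreover have "diameter (Q f) \<le> \<eta>"
    proof (rule diameter_le)
      fix z w assume "z \<in> Q f" "w \<in> Q f"
      then have zw: "z \<in> A" "w \<in> A" and cc: "\<And>b. b \<in> B \<Longrightarrow> cell z b = cell w b" by (auto simp: Q_def)
      have "\<bar>(z - w) \<bullet> b\<bar> \<le> 2 * s / real n" if b: "b \<in> B" for b
      proof -
        have "\<bar>((z - x) \<bullet> b + s) * real n / (2 * s) - ((w - x) \<bullet> b + s) * real n / (2 * s)\<bar> \<le> 1"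
          using co[OF zw(1) b] co[OF zw(2) b] cc[OF b] unfolding cell_def by linarith
        also have "((z - x) \<bullet> b + s) * real n / (2 * s) - ((w - x) \<bullet> b + s) * real n / (2 * s)
            = ((z - w) \<bullet> b) * (real n / (2 * s))"
          using s by (simp add: inner_diff_left field_simps)
        finally have "\<bar>(z - w) \<bullet> b\<bar> * (real n / (2 * s)) \<le> 1" using s by (simp add: abs_mult)
        then show ?thesis using s n by (simp add: field_simps)
      qed
      then have "norm (hyperplane_proj e (z - w)) \<le> (\<Sum>b\<in>B. 2 * s / real n)"
        unfolding pB by (intro sum_norm_le) (simp add: B(3))
      then have p: "norm (hyperplane_proj e (z - w)) \<le> real ?k * (2 * s / real n)" using B by simp
      have "dist (\<gamma> (hyperplane_proj e z)) (\<gamma> (hyperplane_proj e w)) \<le> C * dist (hyperplane_proj e z) (hyperplane_proj e w)"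
        using lipschitz_onD[OF lip] inner_hyperplane_proj[OF e] by blast
      then have h: "\<bar>(z - w) \<bullet> e\<bar> \<le> C * norm (hyperplane_proj e (z - w))"
        using gr zw by (simp add: dist_real_def dist_norm hyperplane_proj_diff inner_diff_left)
      have "z - w = hyperplane_proj e (z - w) + ((z - w) \<bullet> e) *\<^sub>R e"
        by (simp add: hyperplane_proj_def)
      then have "norm (z - w) \<le> norm (hyperplane_proj e (z - w)) + norm (((z - w) \<bullet> e) *\<^sub>R e)"
        by (metis norm_triangle_ineq)
      also have "norm (((z - w) \<bullet> e) *\<^sub>R e) = \<bar>(z - w) \<bullet> e\<bar>" using e by simp
      also have "norm (hyperplane_proj e (z - w)) + \<bar>(z - w) \<bullet> e\<bar> \<le> (1 + C) * norm (hyperplane_proj e (z - w))"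
        using h by (simp only: distrib_right mult_1_left add_left_mono)
      also have "\<dots> \<le> (1 + C) * (real ?k * (2 * s / real n))" using p C by (intro mult_left_mono) auto
      also have "\<dots> = \<eta>" by (simp add: \<eta>_def)
      finally show "norm (z - w) \<le> \<eta>" .
    qed (use \<eta> in simp)
    ultimately show "bounded (Q f) \<and> diameter (Q f) \<le> \<eta>" by blast
  qed (rule \<eta>)+
  also have "\<dots> \<le> ennreal (?ub * (2 * ((1 + C) * real ?k)) ^ ?k * s ^ ?k)"
  proof (rule ennreal_leI)
    have "real (card I) = (real n + 1) ^ ?k" using B by (simp add: I_def card_PiE add.commute)
    also have "\<dots> \<le> (2 * real n) ^ ?k" using n by (intro power_mono) auto
    finally have "real (card I) * (?ub * (\<eta> / 2) ^ ?k) \<le> (2 * real n) ^ ?k * (?ub * (\<eta> / 2) ^ ?k)"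
      using \<eta> by (intro mult_right_mono) auto
    also have "\<dots> = ?ub * ((2 * real n) * (\<eta> / 2)) ^ ?k" unfolding power_mult_distrib by simp
    also have "(2 * real n) * (\<eta> / 2) = (2 * ((1 + C) * real ?k)) * s" using n by (simp add: \<eta>_def)
    finally show "real (card I) * (?ub * (\<eta> / 2) ^ ?k) \<le> ?ub * (2 * ((1 + C) * real ?k)) ^ ?k * s ^ ?k"
      unfolding power_mult_distrib by simp
  qed
  finally show "hausdorff_premeasure ?k \<delta> A \<le> \<dots>" .
qed


section \<open>Ahlfors regularity of the boundary\<close>

text \<open>
  The same number serves as constant and as radius of validity, so that the minimum over a finite
  subcover settles both.
\<close>

lemma compact_uniform_constant:
  fixes K :: "'a::metric_space set" and Q :: "real \<Rightarrow> 'a \<Rightarrow> bool"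
  assumes K: "compact K"
    and loc: "\<And>p. p \<in> K \<Longrightarrow> \<exists>c>0. \<forall>x\<in>K \<inter> ball p c. Q c x"
    and anti: "\<And>c c' x. 0 < c' \<Longrightarrow> c' \<le> c \<Longrightarrow> Q c x \<Longrightarrow> Q c' x"
  shows "\<exists>c>0. \<forall>x\<in>K. Q c x"
proof -
  obtain c where c: "\<And>p. p \<in> K \<Longrightarrow> c p > 0 \<and> (\<forall>x\<in>K \<inter> ball p (c p). Q (c p) x)"
    using loc by metis
  have "K \<subseteq> (\<Union>p\<in>K. ball p (c p))" using c by force
  then obtain F where F: "F \<subseteq> K" "finite F" "K \<subseteq> (\<Union>p\<in>F. ball p (c p))"
    using compactE_image[OF K, of K "\<lambda>p. ball p (c p)"] by auto
  define m where "m = Min (insert 1 (c ` F))"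
  have m: "m > 0" using F c by (auto simp: m_def)
  have "Q m x" if x: "x \<in> K" for x
  proof -
    obtain p where p: "p \<in> F" "x \<in> ball p (c p)" using F x by blast
    have "m \<le> c p" unfolding m_def using p F by (intro Min_le) auto
    then show ?thesis using anti[of m "c p" x] c[of p] p F x m by blast
  qed
  with m show ?thesis by blast
qed

text \<open>
  The two graph bounds hold in each chart, with the Lipschitz constant of the chart, on balls that
  stay inside it; compactness of the boundary makes the constant uniform.
\<close>

lemma surface_measure_ahlfors_regular:
  fixes \<Omega> :: "'a::euclidean_space set"
  assumes bd: "bounded \<Omega>" and \<Omega>: "lipschitz_domain \<Omega>"
  obtains c where "c > 0"
    "\<And>x s. x \<in> frontier \<Omega> \<Longrightarrow> 0 < s \<Longrightarrow> s \<le> c \<Longrightarrow>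
       ennreal (c * s ^ (DIM('a) - 1)) \<le> emeasure surface_measure (frontier \<Omega> \<inter> cball x s)"
    "\<And>x s. x \<in> frontier \<Omega> \<Longrightarrow> 0 < s \<Longrightarrow> s \<le> c \<Longrightarrow>
       emeasure surface_measure (frontier \<Omega> \<inter> cball x s) \<le> ennreal (s ^ (DIM('a) - 1) / c)"
proof -
  let ?K = "frontier \<Omega>"
  let ?k = "DIM('a) - 1"
  let ?ub = "unit_ball_vol (real ?k)"
  define Q where "Q c x \<longleftrightarrow> (\<forall>s. 0 < s \<longrightarrow> s \<le> c \<longrightarrow>
     ennreal (c * s ^ ?k) \<le> emeasure surface_measure (?K \<inter> cball x s) \<and>
     emeasure surface_measure (?K \<inter> cball x s) \<le> ennreal (s ^ ?k / c))" for c x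
  have "\<exists>c>0. \<forall>x\<in>?K. Q c x"
  proof (rule compact_uniform_constant)
    show "compact ?K" using bd by (rule compact_frontier_bounded)
    show "Q c' x" if "0 < c'" "c' \<le> c" "Q c x" for c c' x
      unfolding Q_def
    proof (intro allI impI)
      fix s assume s: "0 < s" "s \<le> c'"
      have "ennreal (c' * s ^ ?k) \<le> ennreal (c * s ^ ?k)" "ennreal (s ^ ?k / c) \<le> ennreal (s ^ ?k / c')"
        using s that by (auto intro!: ennreal_leI mult_right_mono divide_left_mono)
      moreover have "ennreal (c * s ^ ?k) \<le> emeasure surface_measure (?K \<inter> cball x s) \<and>
          emeasure surface_measure (?K \<inter> cball x s) \<le> ennreal (s ^ ?k / c)"
        using that s unfolding Q_def by auto
      ultimately show "ennreal (c' * s ^ ?k) \<le> emeasure surface_measure (?K \<inter> cball x s) \<and>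
          emeasure surface_measure (?K \<inter> cball x s) \<le> ennreal (s ^ ?k / c')"
        by (meson order_trans)
    qed
    fix p assume p: "p \<in> ?K"
    obtain \<rho> e \<gamma> C where \<rho>: "\<rho> > 0" and e: "norm e = 1"
      and lip: "C-lipschitz_on {z. z \<bullet> e = 0} \<gamma>"
      and ch: "\<And>x. x \<in> ball p \<rho> \<Longrightarrow> x \<in> ?K \<longleftrightarrow> \<gamma> (hyperplane_proj e x) = x \<bullet> e"
      by (rule lipschitz_domain_frontier_chart[OF \<Omega> p]) (rule that; assumption)
    have C: "C \<ge> 0" using lip by (rule lipschitz_on_nonneg)
    define c1 where "c1 = ?ub / (16 * (1 + C)) ^ DIM('a)"
    define c2 where "c2 = ?ub * (2 * ((1 + C) * real ?k)) ^ ?k"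
    have c1: "c1 > 0" using C by (simp add: c1_def)
    have c2: "c2 \<ge> 0" using C by (simp add: c2_def)
    define c where "c = min (\<rho> / 3) (min c1 (1 / (c2 + 1)))"
    have c: "c > 0" "c \<le> \<rho> / 3" "c \<le> c1" "c \<le> 1 / (c2 + 1)"
      using \<rho> c1 c2 by (auto simp: c_def)
    have c2c: "c2 \<le> 1 / c"
    proof -
      have "c * (c2 + 1) \<le> 1" using c(4) c2 by (simp add: field_simps)
      then show ?thesis using c(1) by (simp add: field_simps)
    qed
    have "Q c x" if x: "x \<in> ?K \<inter> ball p c" for x
      unfolding Q_def
    proof (intro allI impI)
      fix s assume s: "0 < s" "s \<le> c"
      have sub: "z \<in> ball p \<rho>" if "z \<in> cball x s" for z
        using dist_triangle[of p z x] that x s c by auto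
      have em: "emeasure surface_measure (?K \<inter> cball x s) = hausdorff_outer_measure ?k (?K \<inter> cball x s)"
        by (intro emeasure_hausdorff_measure) auto
      have "ennreal (c * s ^ ?k) \<le> ennreal (c1 * s ^ ?k)"
        using s c by (intro ennreal_leI mult_right_mono) auto
      also have "\<dots> \<le> hausdorff_outer_measure ?k (?K \<inter> cball x s)"
        unfolding c1_def
      proof (rule hausdorff_outer_measure_graph_ge[OF e lip])
        show "\<gamma> (hyperplane_proj e x) = x \<bullet> e" using ch[of x] sub[of x] x s(1) by simp
        show "z \<in> ?K" if "z \<in> cball x s" "\<gamma> (hyperplane_proj e z) = z \<bullet> e" for z
          using ch[OF sub[OF that(1)]] that(2) by blast
      qed (rule s(1))
      finally have 1: "ennreal (c * s ^ ?k) \<le> hausdorff_outer_measure ?k (?K \<inter> cball x s)" .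
      have "hausdorff_outer_measure ?k (?K \<inter> cball x s) \<le> ennreal (c2 * s ^ ?k)"
        unfolding c2_def
      proof (rule hausdorff_outer_measure_graph_le[OF e lip])
        show "\<gamma> (hyperplane_proj e z) = z \<bullet> e" if "z \<in> ?K \<inter> cball x s" for z
          using ch[OF sub, of z] that by blast
      qed (use s in auto)
      also have "\<dots> \<le> ennreal (s ^ ?k / c)"
        using mult_right_mono[OF c2c, of "s ^ ?k"] s by (intro ennreal_leI) simp
      finally show "ennreal (c * s ^ ?k) \<le> emeasure surface_measure (?K \<inter> cball x s) \<and>
          emeasure surface_measure (?K \<inter> cball x s) \<le> ennreal (s ^ ?k / c)"
        using 1 em by simp
    qed
    with c show "\<exists>c>0. \<forall>x\<in>?K \<inter> ball p c. Q c x" by blast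
  qed
  then obtain c where "c > 0" "\<forall>x\<in>?K. Q c x" by blast
  then show thesis by (intro that[of c]) (simp_all add: Q_def)
qed


section \<open>Lower bound for the penalty\<close>

text \<open>
  The double integral without the prefactor, hence free of \<open>\<beta>\<close>: the constants cannot depend on it.
\<close>

definition scaled_penalty ::
  "(real \<Rightarrow> real) \<Rightarrow> (real \<Rightarrow> real) \<Rightarrow> 'a::euclidean_space set \<Rightarrow> real \<Rightarrow> ('a \<Rightarrow> 'a) \<Rightarrow> ennreal"
where
  "scaled_penalty P g \<Omega> \<epsilon> y =
     (\<integral>\<^sup>+x\<in>frontier \<Omega>. (\<integral>\<^sup>+x'\<in>frontier \<Omega>.
        ennreal (1 / \<epsilon> ^ (DIM('a) - 1) * P (g (norm (x' - x)) - g (norm (y x' - y x) / \<epsilon>)))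
        \<partial>surface_measure) \<partial>surface_measure)"

lemma powr_mult_surface_penalty:
  "0 < \<epsilon> \<Longrightarrow> ennreal (\<epsilon> powr \<beta>) * surface_penalty \<beta> P g \<Omega> \<epsilon> y = scaled_penalty P g \<Omega> \<epsilon> y"
  by (simp add: surface_penalty_def scaled_penalty_def mult.assoc[symmetric] ennreal_mult[symmetric])

text \<open>
  If \<open>x\<close> has a partner \<open>x'\<close> at distance more than \<open>\<rho> / 2\<close> whose image is within \<open>r * \<epsilon>\<close> of that of
  \<open>x\<close>, then every boundary point \<open>z\<close> within \<open>\<epsilon> * \<sigma>\<close> of \<open>x'\<close> is still at distance at least \<open>\<rho> / 4\<close> from \<open>x\<close>,
  and its image is within \<open>\<delta> * \<epsilon>\<close> by the upper Lipschitz bound.  For \<open>\<delta>\<close> small the argument of \<open>P\<close>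
  stays in a compact interval of positive numbers, on which \<open>P\<close> is bounded below.  By the lower
  regularity bound these \<open>z\<close> have measure of order \<open>\<epsilon> ^ (d - 1)\<close>, which cancels the prefactor.
\<close>

lemma scaled_penalty_ge:
  fixes \<Omega> :: "'a::euclidean_space set" and g P :: "real \<Rightarrow> real"
  assumes bd: "bounded \<Omega>" and \<Omega>: "lipschitz_domain \<Omega>"
    and gc: "continuous_on {0..} g" and gm: "strict_mono_on {0..} g" and g0: "g 0 = 0"
    and Pc: "continuous_on UNIV P" and Ppos: "\<And>t. 0 < t \<Longrightarrow> 0 < P t"
    and \<rho>: "0 < \<rho>" and L: "0 < L"
  shows "\<exists>r>0. \<exists>a>0. \<exists>\<epsilon>\<^sub>0>0. \<forall>y \<epsilon>. continuous_on (frontier \<Omega>) y \<longrightarrow> locally_bilipschitz \<Omega> \<rho> l L y \<longrightarrow>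
     0 < \<epsilon> \<longrightarrow> \<epsilon> \<le> \<epsilon>\<^sub>0 \<longrightarrow>
     ennreal a * emeasure surface_measure (overlap_set \<Omega> \<rho> y (r * \<epsilon>)) \<le> scaled_penalty P g \<Omega> \<epsilon> y"
proof -
  let ?K = "frontier \<Omega>"
  let ?k = "DIM('a) - 1"
  have K: "compact ?K" using bd by (rule compact_frontier_bounded)
  have gle: "g u \<le> g v" if "0 \<le> u" "u \<le> v" for u v
    using strict_mono_on_leD[OF gm] that by auto
  have glt: "g u < g v" if "0 \<le> u" "u < v" for u v
    using strict_mono_onD[OF gm] that by auto
  obtain c where c: "c > 0"
    and low: "\<And>x s. x \<in> ?K \<Longrightarrow> 0 < s \<Longrightarrow> s \<le> c \<Longrightarrow>
       ennreal (c * s ^ ?k) \<le> emeasure surface_measure (?K \<inter> cball x s)"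
    by (rule surface_measure_ahlfors_regular[OF bd \<Omega>]) (rule that; assumption)
  define t0 where "t0 = g (\<rho> / 4) / 2"
  have t0: "t0 > 0" using glt[of 0 "\<rho> / 4"] \<rho> g0 by (simp add: t0_def)
  obtain \<delta> where \<delta>: "\<delta> > 0" and g\<delta>: "\<And>u. 0 \<le> u \<Longrightarrow> u \<le> \<delta> \<Longrightarrow> g u \<le> t0"
  proof -
    obtain d where d: "d > 0" "\<And>u. u \<in> {0..} \<Longrightarrow> dist u 0 < d \<Longrightarrow> dist (g u) (g 0) < t0"
      using gc[unfolded continuous_on_iff, rule_format, of 0 t0] t0 by auto
    show thesis
    proof (rule that[of "d / 2"])
      show "g u \<le> t0" if "0 \<le> u" "u \<le> d / 2" for u
        using d(2)[of u] d(1) that g0 by (auto simp: dist_real_def)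
    qed (use d in simp)
  qed
  \<comment> \<open>half of the budget \<open>\<delta>\<close> is for the gap between the images of \<open>x\<close> and \<open>x'\<close>, half for moving \<open>x'\<close>\<close>
  define r where "r = \<delta> / 2"
  define \<sigma> where "\<sigma> = \<delta> / (2 * L)"
  have r: "r > 0" and \<sigma>: "\<sigma> > 0" using \<delta> L by (auto simp: r_def \<sigma>_def)
  have r\<sigma>: "r + L * \<sigma> = \<delta>" using L by (simp add: r_def \<sigma>_def field_simps)
  define D where "D = diameter ?K"
  have D: "norm (u - v) \<le> D" if "u \<in> ?K" "v \<in> ?K" for u v
    using diameter_bounded_bound[OF compact_imp_bounded[OF K]] that by (simp add: D_def dist_norm)
  obtain p0 where p0: "p0 > 0" and Pp0: "\<And>t. t0 \<le> t \<Longrightarrow> t \<le> g D \<Longrightarrow> p0 \<le> P t"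
  proof -
    let ?T = "{t0..max t0 (g D)}"
    obtain tm where "tm \<in> ?T" "\<And>t. t \<in> ?T \<Longrightarrow> P tm \<le> P t"
      using continuous_attains_inf[of ?T P] continuous_on_subset[OF Pc] by auto
    moreover from this have "P tm > 0" using t0 by (intro Ppos) auto
    ultimately show thesis by (intro that[of "P tm"]) auto
  qed
  define a where "a = p0 * (c * \<sigma> ^ ?k)"
  have a: "a > 0" using p0 c \<sigma> by (simp add: a_def)
  define \<epsilon>0 where "\<epsilon>0 = min (c / \<sigma>) (\<rho> / (4 * \<sigma>))"
  have \<epsilon>0: "\<epsilon>0 > 0" using c \<sigma> \<rho> by (simp add: \<epsilon>0_def)
  have "ennreal a * emeasure surface_measure (overlap_set \<Omega> \<rho> y (r * \<epsilon>)) \<le> scaled_penalty P g \<Omega> \<epsilon> y"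
    if y: "continuous_on ?K y" and bl: "locally_bilipschitz \<Omega> \<rho> l L y" and \<epsilon>: "0 < \<epsilon>" "\<epsilon> \<le> \<epsilon>0" for y \<epsilon>
  proof -
    let ?f = "\<lambda>x x'. ennreal (1 / \<epsilon> ^ ?k * P (g (norm (x' - x)) - g (norm (y x' - y x) / \<epsilon>)))"
    let ?O = "overlap_set \<Omega> \<rho> y (r * \<epsilon>)"
    have \<epsilon>\<sigma>: "\<epsilon> * \<sigma> > 0" "\<epsilon> * \<sigma> \<le> c" "\<epsilon> * \<sigma> \<le> \<rho> / 4"
      using \<epsilon> \<sigma> by (auto simp: \<epsilon>0_def field_simps)
    have inner: "ennreal a \<le> (\<integral>\<^sup>+x'\<in>?K. ?f x x' \<partial>surface_measure)" if x: "x \<in> ?O" for x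
    proof -
      obtain x' where xK: "x \<in> ?K" and x': "x' \<in> ?K" "norm (y x - y x') \<le> r * \<epsilon>" "norm (x - x') > \<rho> / 2"
        using x by (auto simp: overlap_set_def)
      have pt: "ennreal (p0 / \<epsilon> ^ ?k) \<le> ?f x z" if z: "z \<in> ?K \<inter> cball x' (\<epsilon> * \<sigma>)" for z
      proof -
        have zx': "norm (z - x') \<le> \<epsilon> * \<sigma>" using z by (simp add: dist_norm norm_minus_commute)
        have "norm (x - x') \<le> norm (z - x) + norm (z - x')"
          using norm_triangle_ineq4[of "z - x'" "z - x"] by simp
        then have zx: "norm (z - x) \<ge> \<rho> / 4" using x' zx' \<epsilon>\<sigma> by linarith
        have "norm (y z - y x') \<le> L * norm (z - x')"
          using bl z x'(1) zx' \<epsilon>\<sigma> \<rho> unfolding locally_bilipschitz_def by auto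
        also have "\<dots> \<le> L * (\<epsilon> * \<sigma>)" using zx' L by (intro mult_left_mono) auto
        finally have "norm (y z - y x) \<le> L * (\<epsilon> * \<sigma>) + r * \<epsilon>"
          using norm_triangle_ineq4[of "y z - y x'" "y x - y x'"] x'(2) by simp
        also have "\<dots> = \<delta> * \<epsilon>" by (simp add: r\<sigma>[symmetric] algebra_simps)
        finally have "norm (y z - y x) / \<epsilon> \<le> \<delta>" using \<epsilon> by (simp add: field_simps)
        then have gy: "g (norm (y z - y x) / \<epsilon>) \<le> t0" using \<epsilon> by (intro g\<delta>) auto
        have gy0: "g (norm (y z - y x) / \<epsilon>) \<ge> 0" using gle[of 0] \<epsilon> g0 by simp
        have gx: "g (norm (z - x)) \<ge> 2 * t0" using gle[OF _ zx] \<rho> by (simp add: t0_def)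
        have gD: "g (norm (z - x)) \<le> g D" using z xK by (intro gle D) auto
        have "p0 \<le> P (g (norm (z - x)) - g (norm (y z - y x) / \<epsilon>))"
          using gy gy0 gx gD by (intro Pp0) linarith+
        then show ?thesis
          using \<epsilon> by (intro ennreal_leI) (simp add: divide_right_mono)
      qed
      have "a = (p0 / \<epsilon> ^ ?k) * (c * (\<epsilon> * \<sigma>) ^ ?k)"
        using \<epsilon> by (simp add: a_def power_mult_distrib)
      then have "ennreal a = ennreal (p0 / \<epsilon> ^ ?k) * ennreal (c * (\<epsilon> * \<sigma>) ^ ?k)"
        using p0 c \<epsilon> \<sigma> by (simp only:) (intro ennreal_mult, auto)
      also have "\<dots> \<le> ennreal (p0 / \<epsilon> ^ ?k) * emeasure surface_measure (?K \<inter> cball x' (\<epsilon> * \<sigma>))"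
        using low[OF x'(1) \<epsilon>\<sigma>(1,2)] by (intro mult_left_mono) auto
      also have "\<dots> = (\<integral>\<^sup>+z. ennreal (p0 / \<epsilon> ^ ?k) * indicator (?K \<inter> cball x' (\<epsilon> * \<sigma>)) z \<partial>surface_measure)"
        by (subst nn_integral_cmult_indicator) auto
      also have "\<dots> \<le> (\<integral>\<^sup>+x'\<in>?K. ?f x x' \<partial>surface_measure)"
      proof (rule nn_integral_mono)
        fix z
        show "ennreal (p0 / \<epsilon> ^ ?k) * indicator (?K \<inter> cball x' (\<epsilon> * \<sigma>)) z \<le> ?f x z * indicator ?K z"
          using pt[of z] by (cases "z \<in> ?K \<inter> cball x' (\<epsilon> * \<sigma>)") auto
      qed
      finally show ?thesis .
    qed
    have "ennreal a * emeasure surface_measure ?O = (\<integral>\<^sup>+x. ennreal a * indicator ?O x \<partial>surface_measure)"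
      using overlap_set_borel[OF bd y] by (subst nn_integral_cmult_indicator) auto
    also have "\<dots> \<le> scaled_penalty P g \<Omega> \<epsilon> y"
      unfolding scaled_penalty_def
    proof (rule nn_integral_mono)
      fix x
      show "ennreal a * indicator ?O x \<le> (\<integral>\<^sup>+x'\<in>?K. ?f x x' \<partial>surface_measure) * indicator ?K x"
        using inner[of x] by (cases "x \<in> ?O") (auto simp: overlap_set_def)
    qed
    finally show ?thesis .
  qed
  with r a \<epsilon>0 show ?thesis by blast
qed


section \<open>Upper bound for the penalty\<close>

text \<open>
  The map \<open>y\<close> need not be injective, but in each ball of radius \<open>\<rho> / 2\<close> the points sent to within \<open>t\<close>
  of \<open>v\<close> lie within \<open>2 * t / l\<close> of each other, by the lower Lipschitz bound.  Finitely many such balls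
  cover the boundary, so the number of sheets of \<open>y\<close> meeting near \<open>v\<close> is bounded independently of \<open>y\<close>.
\<close>

lemma emeasure_sublevel_le:
  fixes y :: "'a::euclidean_space \<Rightarrow> 'a"
  assumes F: "finite F" "frontier \<Omega> \<subseteq> (\<Union>p\<in>F. ball p (\<rho> / 2))"
    and bl: "locally_bilipschitz \<Omega> \<rho> l L y" and l: "0 < l"
    and B: "\<And>q. q \<in> frontier \<Omega> \<Longrightarrow> emeasure surface_measure (frontier \<Omega> \<inter> cball q (2 * t / l)) \<le> B"
  obtains T where "T \<in> sets borel" "{z \<in> frontier \<Omega>. norm (y z - v) \<le> t} \<subseteq> T"
    "emeasure surface_measure T \<le> of_nat (card F) * B"
proof -
  let ?K = "frontier \<Omega>"
  define S where "S = {z \<in> ?K. norm (y z - v) \<le> t}"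
  define F' where "F' = {p \<in> F. S \<inter> ball p (\<rho> / 2) \<noteq> {}}"
  have "\<forall>p\<in>F'. \<exists>z. z \<in> S \<inter> ball p (\<rho> / 2)" by (auto simp: F'_def)
  from bchoice[OF this] obtain q where q: "\<And>p. p \<in> F' \<Longrightarrow> q p \<in> S \<inter> ball p (\<rho> / 2)" by blast
  define T where "T = (\<Union>p\<in>F'. ?K \<inter> cball (q p) (2 * t / l))"
  have F': "finite F'" "card F' \<le> card F" using F by (auto simp: F'_def intro: card_mono)
  show thesis
  proof (rule that[of T])
    show "T \<in> sets borel"
      unfolding T_def using F' by (intro sets.finite_UN) auto
    show "{z \<in> ?K. norm (y z - v) \<le> t} \<subseteq> T"
    proof
      fix z assume "z \<in> {z \<in> ?K. norm (y z - v) \<le> t}"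
      then have zS: "z \<in> S" by (simp add: S_def)
      then obtain p where p: "p \<in> F" "z \<in> ball p (\<rho> / 2)" using F by (auto simp: S_def)
      then have pF: "p \<in> F'" using zS by (auto simp: F'_def)
      have "norm (q p - z) < \<rho>"
        using q[OF pF] p dist_triangle_half_r[of p "q p" \<rho> z] by (simp add: dist_norm)
      then have "l * norm (q p - z) \<le> norm (y (q p) - y z)"
        using bl q[OF pF] zS unfolding locally_bilipschitz_def S_def by blast
      also have "\<dots> \<le> 2 * t"
        using norm_triangle_ineq4[of "y (q p) - v" "y z - v"] q[OF pF] zS by (simp add: S_def)
      finally have "z \<in> cball (q p) (2 * t / l)" using l by (simp add: dist_norm field_simps)
      then show "z \<in> T" using pF zS by (auto simp: T_def S_def)
    qed
    have "emeasure surface_measure T \<le> (\<Sum>p\<in>F'. emeasure surface_measure (?K \<inter> cball (q p) (2 * t / l)))"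
      unfolding T_def using F' by (intro emeasure_subadditive_finite) auto
    also have "\<dots> \<le> (\<Sum>p\<in>F'. B)" using q by (intro sum_mono B) (auto simp: S_def)
    also have "\<dots> \<le> of_nat (card F) * B" using F' by (simp add: mult_right_mono)
    finally show "emeasure surface_measure T \<le> of_nat (card F) * B" .
  qed
qed

text \<open>
  Where the integrand is positive, \<open>norm (y x' - y x) < \<epsilon> * norm (x' - x)\<close> because \<open>g\<close> is increasing.
  For \<open>\<epsilon> \<le> l\<close> this contradicts the lower Lipschitz bound unless \<open>x\<close> and \<open>x'\<close> are at distance at least
  \<open>\<rho>\<close>; and as the boundary is bounded, the images are within \<open>R * \<epsilon>\<close>.  So \<open>x\<close> is an overlap point.
  For such \<open>x\<close> the relevant \<open>x'\<close> have measure of order \<open>\<epsilon> ^ (d - 1)\<close> by the sheet count, and \<open>P\<close> is at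
  most \<open>g R\<close> there.
\<close>

lemma scaled_penalty_le:
  fixes \<Omega> :: "'a::euclidean_space set" and g P :: "real \<Rightarrow> real"
  assumes bd: "bounded \<Omega>" and \<Omega>: "lipschitz_domain \<Omega>"
    and gm: "strict_mono_on {0..} g" and g0: "g 0 = 0"
    and P: "\<And>t. P t \<le> max 0 t"
    and \<rho>: "0 < \<rho>" and l: "0 < l"
  shows "\<exists>R>0. \<exists>A>0. \<exists>\<epsilon>\<^sub>0>0. \<forall>y \<epsilon>. continuous_on (frontier \<Omega>) y \<longrightarrow> locally_bilipschitz \<Omega> \<rho> l L y \<longrightarrow>
     0 < \<epsilon> \<longrightarrow> \<epsilon> \<le> \<epsilon>\<^sub>0 \<longrightarrow>
     scaled_penalty P g \<Omega> \<epsilon> y \<le> ennreal A * emeasure surface_measure (overlap_set \<Omega> \<rho> y (R * \<epsilon>))"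
proof -
  let ?K = "frontier \<Omega>"
  let ?k = "DIM('a) - 1"
  have K: "compact ?K" using bd by (rule compact_frontier_bounded)
  have gle: "g u \<le> g v" if "0 \<le> u" "u \<le> v" for u v
    using strict_mono_on_leD[OF gm] that by auto
  obtain c where c: "c > 0"
    and upp: "\<And>x s. x \<in> ?K \<Longrightarrow> 0 < s \<Longrightarrow> s \<le> c \<Longrightarrow>
       emeasure surface_measure (?K \<inter> cball x s) \<le> ennreal (s ^ ?k / c)"
    by (rule surface_measure_ahlfors_regular[OF bd \<Omega>]) (rule that; assumption)
  obtain F where F: "finite F" "?K \<subseteq> (\<Union>p\<in>F. ball p (\<rho> / 2))"
  proof -
    have "?K \<subseteq> (\<Union>p\<in>?K. ball p (\<rho> / 2))" using \<rho> by force
    with K show thesis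
      by (rule compactE_image[OF _ open_ball]) (rule that)
  qed
  define R where "R = diameter ?K + 1"
  have R: "R > 0" using diameter_ge_0[OF compact_imp_bounded[OF K]] by (simp add: R_def)
  have RK: "norm (u - v) \<le> R" if "u \<in> ?K" "v \<in> ?K" for u v
    using diameter_bounded_bound[OF compact_imp_bounded[OF K] that] by (simp add: R_def dist_norm)
  have gR: "g R \<ge> 0" using gle[of 0 R] R g0 by simp
  \<comment> \<open>the summand 1 keeps \<open>A\<close> positive when the boundary needs no covering ball\<close>
  define A where "A = g R * (real (card F) * ((2 * R / l) ^ ?k / c)) + 1"
  have A: "A > 0" using gR R l c by (auto simp: A_def intro!: add_nonneg_pos)
  define \<epsilon>0 where "\<epsilon>0 = min l (c * l / (2 * R))"
  have \<epsilon>0: "\<epsilon>0 > 0" using c l R by (simp add: \<epsilon>0_def)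
  have "scaled_penalty P g \<Omega> \<epsilon> y \<le> ennreal A * emeasure surface_measure (overlap_set \<Omega> \<rho> y (R * \<epsilon>))"
    if y: "continuous_on ?K y" and bl: "locally_bilipschitz \<Omega> \<rho> l L y" and \<epsilon>: "0 < \<epsilon>" "\<epsilon> \<le> \<epsilon>0" for y \<epsilon>
  proof -
    let ?f = "\<lambda>x x'. ennreal (1 / \<epsilon> ^ ?k * P (g (norm (x' - x)) - g (norm (y x' - y x) / \<epsilon>)))"
    let ?O = "overlap_set \<Omega> \<rho> y (R * \<epsilon>)"
    let ?t = "R * \<epsilon>"
    have tl: "2 * ?t / l > 0" "2 * ?t / l \<le> c" and \<epsilon>l: "\<epsilon> \<le> l"
      using \<epsilon> R l by (auto simp: \<epsilon>0_def field_simps)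
    have supp: "norm (x - z) > \<rho> / 2 \<and> norm (y x - y z) \<le> ?t"
      if xz: "x \<in> ?K" "z \<in> ?K" and pos: "?f x z \<noteq> 0" for x z
    proof -
      have "1 / \<epsilon> ^ ?k * P (g (norm (z - x)) - g (norm (y z - y x) / \<epsilon>)) > 0"
        using pos by (metis ennreal_neg not_le)
      then have "P (g (norm (z - x)) - g (norm (y z - y x) / \<epsilon>)) > 0"
        using \<epsilon> by (simp add: zero_less_divide_iff)
      then have "g (norm (y z - y x) / \<epsilon>) < g (norm (z - x))"
        using P[of "g (norm (z - x)) - g (norm (y z - y x) / \<epsilon>)"] by linarith
      then have "norm (y z - y x) / \<epsilon> < norm (z - x)"
        using gle[of "norm (z - x)" "norm (y z - y x) / \<epsilon>"] by (meson norm_ge_zero not_le)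
      then have lt: "norm (y z - y x) < \<epsilon> * norm (z - x)" using \<epsilon> by (simp add: field_simps)
      have "\<not> norm (z - x) < \<rho>"
      proof
        assume "norm (z - x) < \<rho>"
        then have "l * norm (z - x) \<le> norm (y z - y x)"
          using bl xz unfolding locally_bilipschitz_def by blast
        moreover have "\<epsilon> * norm (z - x) \<le> l * norm (z - x)" using \<epsilon>l by (intro mult_right_mono) auto
        ultimately show False using lt by linarith
      qed
      moreover have "\<epsilon> * norm (z - x) \<le> \<epsilon> * R" using RK xz \<epsilon> by (intro mult_left_mono) auto
      ultimately show ?thesis using lt \<rho> by (auto simp: norm_minus_commute mult.commute)
    qed
    have bound: "?f x z \<le> ennreal (g R / \<epsilon> ^ ?k)" if "x \<in> ?K" "z \<in> ?K" for x z
    proof (rule ennreal_leI)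
      have "g (norm (z - x)) \<le> g R" using that by (intro gle RK) auto
      moreover have "g (norm (y z - y x) / \<epsilon>) \<ge> 0" using gle[of 0] \<epsilon> g0 by simp
      ultimately have "P (g (norm (z - x)) - g (norm (y z - y x) / \<epsilon>)) \<le> g R"
        using P[of "g (norm (z - x)) - g (norm (y z - y x) / \<epsilon>)"] gR by linarith
      then show "1 / \<epsilon> ^ ?k * P (g (norm (z - x)) - g (norm (y z - y x) / \<epsilon>)) \<le> g R / \<epsilon> ^ ?k"
        using \<epsilon> by (simp add: divide_right_mono)
    qed
    have inner: "(\<integral>\<^sup>+x'\<in>?K. ?f x x' \<partial>surface_measure) \<le> ennreal A" if x: "x \<in> ?K" for x
    proof -
      obtain T where T: "T \<in> sets borel" "{z \<in> ?K. norm (y z - y x) \<le> ?t} \<subseteq> T"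
        "emeasure surface_measure T \<le> of_nat (card F) * ennreal ((2 * ?t / l) ^ ?k / c)"
        by (rule emeasure_sublevel_le[OF F bl l upp[OF _ tl], where v = "y x"])
      have "(\<integral>\<^sup>+x'\<in>?K. ?f x x' \<partial>surface_measure) \<le> (\<integral>\<^sup>+z. ennreal (g R / \<epsilon> ^ ?k) * indicator T z \<partial>surface_measure)"
      proof (rule nn_integral_mono)
        fix z
        show "?f x z * indicator ?K z \<le> ennreal (g R / \<epsilon> ^ ?k) * indicator T z"
        proof (cases "z \<in> ?K \<and> ?f x z \<noteq> 0")
          case True
          then have "z \<in> T" using supp[OF x, of z] T(2) by (auto simp: norm_minus_commute)
          then show ?thesis using True bound[OF x, of z] by simp
        qed auto
      qed
      also have "\<dots> = ennreal (g R / \<epsilon> ^ ?k) * emeasure surface_measure T"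
        using T by (subst nn_integral_cmult_indicator) auto
      also have "\<dots> \<le> ennreal (g R / \<epsilon> ^ ?k) * (of_nat (card F) * ennreal ((2 * ?t / l) ^ ?k / c))"
        using T by (intro mult_left_mono) auto
      also have "\<dots> = ennreal (g R / \<epsilon> ^ ?k * (real (card F) * ((2 * ?t / l) ^ ?k / c)))"
        unfolding ennreal_of_nat_eq_real_of_nat
        using gR \<epsilon> R l c by (subst ennreal_mult, simp, simp, subst ennreal_mult, simp_all)
      also have "g R / \<epsilon> ^ ?k * (real (card F) * ((2 * ?t / l) ^ ?k / c)) = A - 1"
        using \<epsilon> by (simp add: A_def power_mult_distrib power_divide)
      finally show ?thesis by (rule order_trans) (intro ennreal_leI, simp)
    qed
    have "scaled_penalty P g \<Omega> \<epsilon> y \<le> (\<integral>\<^sup>+x. ennreal A * indicator ?O x \<partial>surface_measure)"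
      unfolding scaled_penalty_def
    proof (rule nn_integral_mono)
      fix x
      show "(\<integral>\<^sup>+x'\<in>?K. ?f x x' \<partial>surface_measure) * indicator ?K x \<le> ennreal A * indicator ?O x"
      proof (cases "x \<in> ?K")
        case xK: True
        show ?thesis
        proof (cases "x \<in> ?O")
          case True
          then show ?thesis using inner[OF xK] xK by simp
        next
          case False
          then have z: "?f x z * indicator ?K z = 0" for z
            using supp[OF xK, of z] xK by (cases "z \<in> ?K") (auto simp: overlap_set_def)
          have "(\<integral>\<^sup>+x'\<in>?K. ?f x x' \<partial>surface_measure) = 0"
            unfolding z by simp
          then show ?thesis by simp
        qed
      qed simp
    qed
    also have "\<dots> = ennreal A * emeasure surface_measure ?O"
      using overlap_set_borel[OF bd y] by (subst nn_integral_cmult_indicator) auto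
    finally show ?thesis .
  qed
  with R A \<epsilon>0 show ?thesis by blast
qed

theorem theorem1:
  fixes \<Omega> :: "'a::euclidean_space set"
    and g P :: "real \<Rightarrow> real"
    and \<rho> l L :: real
  assumes "bounded \<Omega>" and "lipschitz_domain \<Omega>"
    and "continuous_on {0..} g" and "strict_mono_on {0..} g" and "g 0 = 0"
    and "\<And>s. 0 \<le> s \<Longrightarrow> 0 \<le> g s"
    and "continuous_on UNIV P" and "\<And>t. 0 \<le> P t"
    and "\<And>t. max 0 (t - 1) \<le> P t \<and> P t \<le> max 0 t"
    and "\<And>t. 0 < t \<Longrightarrow> 0 < P t"
    and "0 < \<rho>" and "0 < l" and "0 < L"
  shows "\<exists>r>0. \<exists>R>0. \<exists>a>0. \<exists>A>0. \<exists>\<epsilon>\<^sub>0>0.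
    \<forall>\<beta>>0. \<forall>y :: 'a \<Rightarrow> 'a.
      continuous_on (frontier \<Omega>) y \<longrightarrow> locally_bilipschitz \<Omega> \<rho> l L y \<longrightarrow>
      (\<forall>\<epsilon>. 0 < \<epsilon> \<and> \<epsilon> \<le> \<epsilon>\<^sub>0 \<longrightarrow>
         ennreal a * emeasure surface_measure (overlap_set \<Omega> \<rho> y (r * \<epsilon>))
           \<le> ennreal (\<epsilon> powr \<beta>) * surface_penalty \<beta> P g \<Omega> \<epsilon> y \<and>
         ennreal (\<epsilon> powr \<beta>) * surface_penalty \<beta> P g \<Omega> \<epsilon> y
           \<le> ennreal A * emeasure surface_measure (overlap_set \<Omega> \<rho> y (R * \<epsilon>)))"
proof -
  have Ple: "P t \<le> max 0 t" for t using assms(9) by blast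
  obtain r a \<epsilon>1 where lower: "r > 0" "a > 0" "\<epsilon>1 > 0"
    "\<And>y \<epsilon>. continuous_on (frontier \<Omega>) y \<Longrightarrow> locally_bilipschitz \<Omega> \<rho> l L y \<Longrightarrow> 0 < \<epsilon> \<Longrightarrow> \<epsilon> \<le> \<epsilon>1 \<Longrightarrow>
     ennreal a * emeasure surface_measure (overlap_set \<Omega> \<rho> y (r * \<epsilon>)) \<le> scaled_penalty P g \<Omega> \<epsilon> y"
    using scaled_penalty_ge[OF assms(1-5,7,10,11,13), of l] by blast
  obtain R A \<epsilon>2 where upper: "R > 0" "A > 0" "\<epsilon>2 > 0"
    "\<And>y \<epsilon>. continuous_on (frontier \<Omega>) y \<Longrightarrow> locally_bilipschitz \<Omega> \<rho> l L y \<Longrightarrow> 0 < \<epsilon> \<Longrightarrow> \<epsilon> \<le> \<epsilon>2 \<Longrightarrow>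
     scaled_penalty P g \<Omega> \<epsilon> y \<le> ennreal A * emeasure surface_measure (overlap_set \<Omega> \<rho> y (R * \<epsilon>))"
    using scaled_penalty_le[OF assms(1,2,4,5) Ple assms(11,12), of L] by blast
  show ?thesis
    by (rule exI[of _ r], rule conjI[OF lower(1)], rule exI[of _ R], rule conjI[OF upper(1)],
        rule exI[of _ a], rule conjI[OF lower(2)], rule exI[of _ A], rule conjI[OF upper(2)],
        rule exI[of _ "min \<epsilon>1 \<epsilon>2"])
       (use lower(3,4) upper(3,4) in \<open>auto simp: powr_mult_surface_penalty\<close>)
qed

end
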